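(* Let $\varepsilon>0$ be any constant. If \textsc{Capacitated Vertex Cover} can be solved in time $2^{\mathcal{O}(\mathrm{vc}^{2-\varepsilon})} n^{\mathcal{O}(1)}$, where $\mathrm{vc}$ denotes the vertex cover number of the input graph and $n$ the input size, then there exists a $2^{\mathcal{O}(m^{2-\varepsilon})} n^{\mathcal{O}(1)}$-time algorithm for \textsc{Set Multicover}, where $m$ denotes the size of the universe.
   Context: \textsc{Capacitated Vertex Cover}: the input is an undirected loopless graph $G=(V,E)$, a capacity function $c\colon V\to\mathbb{N}$, and an integer $k$; the question is whether there exists $S\subseteq V$ with $|S|\le k$ and an assignment of every edge to one of its endpoints lying in $S$ such that every $v\in S$ is assigned at most $c(v)$ incident edges. The vertex cover number of a graph is the minimum size of a set of vertices meeting every edge. \textsc{Set Multicover}: the input is a universe $U=[m]$, sets $S_1,\dots,S_n\subseteq U$, and integers $b,k\in\mathbb{N}$; the question is whether there is a subfamily of at most $k$ of these sets such that every element of $U$ belongs to at least $b$ chosen sets. *)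

theory Defs
  imports Complex_Main "HOL-Library.Landau_Symbols"
begin

section \<open>Machine model\<close>

text \<open>
  Running times refer to the language WHILE of N. D. Jones (Computability and Complexity from a
  Programming Perspective, 1997): structured programs over binary trees in which every elementary
  operation costs one unit.  There is no unit-cost test for equality of trees, so subtrees can be
  shared and every operation takes constant time on a pointer machine.  WHILE and
  deterministic Turing machines simulate each other with polynomial overhead, and a time bound
  of the form \<open>2\<^bsup>O(f(\<kappa>))\<^esup> n\<^bsup>O(1)\<^esup>\<close> is invariant under such overhead.
\<close>

datatype data = Atom | Pair data data

primrec fst_data :: "data \<Rightarrow> data" where
  "fst_data Atom = Atom"
| "fst_data (Pair a b) = a"

primrec snd_data :: "data \<Rightarrow> data" where
  "snd_data Atom = Atom"
| "snd_data (Pair a b) = b"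

primrec data_size :: "data \<Rightarrow> nat" where
  "data_size Atom = 1"
| "data_size (Pair a b) = 1 + data_size a + data_size b"

type_synonym store = "nat \<Rightarrow> data"

datatype expr = Var nat | ENil | ECons expr expr | EHd expr | ETl expr

primrec eval_expr :: "expr \<Rightarrow> store \<Rightarrow> data" where
  "eval_expr (Var x) s = s x"
| "eval_expr ENil s = Atom"
| "eval_expr (ECons e f) s = Pair (eval_expr e s) (eval_expr f s)"
| "eval_expr (EHd e) s = fst_data (eval_expr e s)"
| "eval_expr (ETl e) s = snd_data (eval_expr e s)"

primrec expr_cost :: "expr \<Rightarrow> nat" where
  "expr_cost (Var x) = 1"
| "expr_cost ENil = 1"
| "expr_cost (ECons e f) = 1 + expr_cost e + expr_cost f"
| "expr_cost (EHd e) = 1 + expr_cost e"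
| "expr_cost (ETl e) = 1 + expr_cost e"

datatype prog =
    Skip
  | Assign nat expr
  | Seq prog prog
  | Cond expr prog prog
  | While expr prog

text \<open>
  \<open>exec p s t s'\<close>: started in store \<open>s\<close>, the program \<open>p\<close> halts after exactly \<open>t\<close> steps in
  store \<open>s'\<close>.  In tests, \<open>Atom\<close> is false and every other tree is true.
\<close>

inductive exec :: "prog \<Rightarrow> store \<Rightarrow> nat \<Rightarrow> store \<Rightarrow> bool" where
  exec_Skip: "exec Skip s 1 s"
| exec_Assign: "exec (Assign x e) s (1 + expr_cost e) (s(x := eval_expr e s))"
| exec_Seq: "exec p s t s' \<Longrightarrow> exec q s' u s'' \<Longrightarrow> exec (Seq p q) s (t + u) s''"
| exec_Cond_true: "eval_expr e s \<noteq> Atom \<Longrightarrow> exec p s t s' \<Longrightarrow>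
    exec (Cond e p q) s (1 + expr_cost e + t) s'"
| exec_Cond_false: "eval_expr e s = Atom \<Longrightarrow> exec q s t s' \<Longrightarrow>
    exec (Cond e p q) s (1 + expr_cost e + t) s'"
| exec_While_false: "eval_expr e s = Atom \<Longrightarrow> exec (While e p) s (1 + expr_cost e) s"
| exec_While_true: "eval_expr e s \<noteq> Atom \<Longrightarrow> exec p s t s' \<Longrightarrow> exec (While e p) s' u s'' \<Longrightarrow>
    exec (While e p) s (1 + expr_cost e + t + u) s''"

inductive_cases exec_SkipE: "exec Skip s t s'"
inductive_cases exec_AssignE: "exec (Assign x e) s t s'"
inductive_cases exec_SeqE: "exec (Seq p q) s t s'"
inductive_cases exec_CondE: "exec (Cond e p q) s t s'"
inductive_cases exec_WhileE: "exec (While e p) s t s'"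

lemma exec_deterministic:
  "exec p s t s' \<Longrightarrow> exec p s u s'' \<Longrightarrow> u = t \<and> s'' = s'"
proof (induction arbitrary: u s'' rule: exec.induct)
  case (exec_Skip s)
  then show ?case by (rule exec_SkipE) simp
next
  case (exec_Assign x e s)
  then show ?case by (rule exec_AssignE) simp
next
  case (exec_Seq p s t s' q v r)
  from exec_Seq.prems show ?case
    by (rule exec_SeqE) (use exec_Seq.IH in metis)
next
  case (exec_Cond_true e s p t s' q)
  from exec_Cond_true.prems show ?case
    by (rule exec_CondE) (use exec_Cond_true.hyps in \<open>auto dest!: exec_Cond_true.IH\<close>)
next
  case (exec_Cond_false e s q t s' p)
  from exec_Cond_false.prems show ?case
    by (rule exec_CondE) (use exec_Cond_false.hyps in \<open>auto dest!: exec_Cond_false.IH\<close>)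
next
  case (exec_While_false e s p)
  from exec_While_false.prems show ?case
    by (rule exec_WhileE) (use exec_While_false.hyps in simp_all)
next
  case (exec_While_true e s p t s' v r)
  from exec_While_true.prems show ?case
    by (rule exec_WhileE) (use exec_While_true.hyps in \<open>auto dest!: exec_While_true.IH\<close>)
qed

text \<open>Input and output are passed in variable 0; all other variables initially hold \<open>Atom\<close>.\<close>

definition input_store :: "data \<Rightarrow> store" where
  "input_store d = (\<lambda>_. Atom)(0 := d)"

text \<open>
  A decision problem consists of a set \<open>X\<close> of instances, a relation \<open>codes\<close> telling which trees
  represent an instance, and the set of yes-instances \<open>yes\<close>.  An algorithm has to answer
  correctly on every representation of every instance.  The predicate below says that some
  algorithm runs in time \<open>2\<^bsup>O(f(\<kappa>))\<^esup> n\<^bsup>O(1)\<^esup>\<close>, with \<open>\<kappa>\<close> the parameter and \<open>n\<close> the input size.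
\<close>

definition solvable_in_2_to_O_poly ::
  "'i set \<Rightarrow> ('i \<Rightarrow> data \<Rightarrow> bool) \<Rightarrow> ('i \<Rightarrow> bool) \<Rightarrow> ('i \<Rightarrow> nat) \<Rightarrow> (nat \<Rightarrow> real) \<Rightarrow> bool" where
  "solvable_in_2_to_O_poly X codes yes \<kappa> f \<longleftrightarrow>
    (\<exists>(p :: prog) (g :: nat \<Rightarrow> real) (q :: nat \<Rightarrow> real) (e :: nat).
      g \<in> O(f) \<and> q \<in> O(\<lambda>n. real n ^ e) \<and>
      (\<forall>x\<in>X. \<forall>d. codes x d \<longrightarrow>
        (\<exists>t s. exec p (input_store d) t s \<and>
               real t \<le> 2 powr g (\<kappa> x) * q (data_size d) \<and>
               (s 0 \<noteq> Atom \<longleftrightarrow> yes x))))"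


section \<open>Encodings\<close>

text \<open>Numbers are written in binary, least significant bit first, without leading zeros.\<close>

fun enc_nat :: "nat \<Rightarrow> data" where
  "enc_nat n = (if n = 0 then Atom
     else Pair (if even n then Atom else Pair Atom Atom) (enc_nat (n div 2)))"

declare enc_nat.simps [simp del]

primrec enc_list :: "('a \<Rightarrow> data) \<Rightarrow> 'a list \<Rightarrow> data" where
  "enc_list h [] = Atom"
| "enc_list h (x # xs) = Pair (h x) (enc_list h xs)"

fun enc_prod :: "('a \<Rightarrow> data) \<Rightarrow> ('b \<Rightarrow> data) \<Rightarrow> 'a \<times> 'b \<Rightarrow> data" where
  "enc_prod h k (x, y) = Pair (h x) (k y)"


section \<open>Capacitated Vertex Cover\<close>

definition simple_graph :: "'v set \<Rightarrow> 'v set set \<Rightarrow> bool" where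
  "simple_graph V E \<longleftrightarrow> finite V \<and> (\<forall>e\<in>E. e \<subseteq> V \<and> card e = 2)"

definition vertex_cover_number :: "'v set \<Rightarrow> 'v set set \<Rightarrow> nat" where
  "vertex_cover_number V E = Min (card ` {X. X \<subseteq> V \<and> (\<forall>e\<in>E. X \<inter> e \<noteq> {})})"

definition capacitated_vertex_cover :: "'v set \<Rightarrow> 'v set set \<Rightarrow> ('v \<Rightarrow> nat) \<Rightarrow> nat \<Rightarrow> bool" where
  "capacitated_vertex_cover V E c k \<longleftrightarrow>
    (\<exists>S a. S \<subseteq> V \<and> card S \<le> k \<and> (\<forall>e\<in>E. a e \<in> e \<inter> S) \<and>
           (\<forall>v\<in>S. card {e \<in> E. a e = v} \<le> c v))"

text \<open>Vertices are natural numbers; values of the capacity function outside \<open>V\<close> are irrelevant.\<close>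

type_synonym cvc_instance = "nat set \<times> nat set set \<times> (nat \<Rightarrow> nat) \<times> nat"

definition cvc_instances :: "cvc_instance set" where
  "cvc_instances = {(V, E, c, k). simple_graph V E}"

text \<open>
  An instance is represented by a repetition-free list of its vertices together with their
  capacities, a repetition-free list of its edges (each written as a pair of endpoints, in either
  order), and the number \<open>k\<close>.
\<close>

fun cvc_codes :: "cvc_instance \<Rightarrow> data \<Rightarrow> bool" where
  "cvc_codes (V, E, c, k) d \<longleftrightarrow>
    (\<exists>vs es. distinct vs \<and> set vs = V \<and>
       distinct (map (\<lambda>(u, v). {u, v}) es) \<and> set (map (\<lambda>(u, v). {u, v}) es) = E \<and>
       d = Pair (enc_list (enc_prod enc_nat enc_nat) (map (\<lambda>v. (v, c v)) vs))
             (Pair (enc_list (enc_prod enc_nat enc_nat) es) (enc_nat k)))"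

fun cvc_yes :: "cvc_instance \<Rightarrow> bool" where
  "cvc_yes (V, E, c, k) \<longleftrightarrow> capacitated_vertex_cover V E c k"

fun cvc_param :: "cvc_instance \<Rightarrow> nat" where
  "cvc_param (V, E, c, k) = vertex_cover_number V E"


section \<open>Set Multicover\<close>

text \<open>
  The sets form an indexed family (a list), so the same set may occur several times, and each
  occurrence can be chosen once.
\<close>

definition set_multicover :: "nat \<Rightarrow> nat set list \<Rightarrow> nat \<Rightarrow> nat \<Rightarrow> bool" where
  "set_multicover m \<S> b k \<longleftrightarrow>
    (\<exists>I \<subseteq> {..<length \<S>}. card I \<le> k \<and> (\<forall>u\<in>{1..m}. b \<le> card {i \<in> I. u \<in> \<S> ! i}))"

type_synonym smc_instance = "nat \<times> nat set list \<times> nat \<times> nat"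

definition smc_instances :: "smc_instance set" where
  "smc_instances = {(m, \<S>, b, k). \<forall>A\<in>set \<S>. A \<subseteq> {1..m}}"

text \<open>
  The universe is written down explicitly as the list of its elements, so the input size is at
  least \<open>m\<close>; every set is given by a repetition-free list of its elements.
\<close>

fun smc_codes :: "smc_instance \<Rightarrow> data \<Rightarrow> bool" where
  "smc_codes (m, \<S>, b, k) d \<longleftrightarrow>
    (\<exists>ls. map set ls = \<S> \<and> (\<forall>l\<in>set ls. distinct l) \<and>
       d = Pair (enc_list enc_nat [1..<Suc m])
             (Pair (enc_list (enc_list enc_nat) ls) (Pair (enc_nat b) (enc_nat k))))"

fun smc_yes :: "smc_instance \<Rightarrow> bool" where
  "smc_yes (m, \<S>, b, k) \<longleftrightarrow> set_multicover m \<S> b k"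

fun smc_param :: "smc_instance \<Rightarrow> nat" where
  "smc_param (m, \<S>, b, k) = m"

end

theory Submission
  imports Defs
begin

text \<open>
  Represent each set by a vertex adjacent to the vertices of its elements, and force every element
  vertex \<open>u\<close> into the cover by a pendant neighbour of capacity 0.  If \<open>u\<close> lies in \<open>d\<close> sets, give
  it capacity \<open>1 + d - b\<close>: besides its pendant edge it can serve at most \<open>d - b\<close> of its \<open>d\<close> other
  edges, so at least \<open>b\<close> of them must be served by chosen sets, which have ample capacity.  With the
  budget \<open>k + m\<close> at most \<open>k\<close> sets can be chosen.  The element vertices cover all edges, so the
  vertex cover number is at most \<open>m\<close>.  That the reduction runs in polynomial time follows from
  closure properties of the polynomial-time functions on trees.
\<close>

section \<open>Polynomial bounds\<close>

text \<open>The machine model is the obstacle: a program with a time bound on concrete trees has to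
  be exhibited, although the language has neither arithmetic nor a unit-cost equality test. The
  reduction is therefore written as a function on trees, built from pairing, projections, case
  distinctions and left folds over lists, all of which preserve \<open>poly_time\<close>. That
  notion speaks about all trees and all initial stores, so subprograms can be run one after the
  other without cleaning up, and well-formed codes enter only in the correctness proof. The vertex
  numbers are chosen to suit binary numerals with the low bit first: \<open>4 * u\<close>,
  \<open>4 * u + 2\<close> and \<open>2 * i + 1\<close> arise by putting bits in front of the
  numerals of \<open>u\<close> and \<open>i\<close>. The arithmetic that remains is increment and
  equality. The parameter does not grow, but the constants hidden in the \<open>O\<close> of the
  exponent produce a constant factor in the running time, which moves into the polynomial.\<close>

definition poly_bounded :: "(data \<Rightarrow> nat) \<Rightarrow> bool" where
  "poly_bounded h \<longleftrightarrow> (\<exists>C e. \<forall>x. h x \<le> C * data_size x ^ e)"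

lemma data_size_pos [simp]: "0 < data_size x"
  by (cases x) auto

lemma data_size_ge_1 [simp]: "Suc 0 \<le> data_size x"
  by (cases x) auto

lemma poly_bounded_mono: "poly_bounded g \<Longrightarrow> (\<And>x. h x \<le> g x) \<Longrightarrow> poly_bounded h"
  unfolding poly_bounded_def by (meson le_trans)

lemma poly_bounded_const: "poly_bounded (\<lambda>x. c)"
  unfolding poly_bounded_def by (rule exI[of _ c], rule exI[of _ 0]) simp

lemma poly_bounded_data_size: "poly_bounded data_size"
  unfolding poly_bounded_def by (rule exI[of _ 1], rule exI[of _ 1]) simp

lemma poly_bounded_add:
  assumes "poly_bounded g" "poly_bounded h"
  shows "poly_bounded (\<lambda>x. g x + h x)"
proof -
  obtain C e D k where C: "\<And>x. g x \<le> C * data_size x ^ e" and D: "\<And>x. h x \<le> D * data_size x ^ k"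
    using assms unfolding poly_bounded_def by blast
  have "g x + h x \<le> (C + D) * data_size x ^ (e + k)" for x
  proof -
    have "data_size x ^ e \<le> data_size x ^ (e + k)" "data_size x ^ k \<le> data_size x ^ (e + k)"
      by (auto intro!: power_increasing)
    then have "C * data_size x ^ e \<le> C * data_size x ^ (e + k)"
      "D * data_size x ^ k \<le> D * data_size x ^ (e + k)" by simp_all
    then show ?thesis using C[of x] D[of x] unfolding add_mult_distrib by linarith
  qed
  then show ?thesis unfolding poly_bounded_def by blast
qed

lemma poly_bounded_mult:
  assumes "poly_bounded g" "poly_bounded h"
  shows "poly_bounded (\<lambda>x. g x * h x)"
proof -
  obtain C e D k where C: "\<And>x. g x \<le> C * data_size x ^ e" and D: "\<And>x. h x \<le> D * data_size x ^ k"
    using assms unfolding poly_bounded_def by blast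
  have "g x * h x \<le> (C * D) * data_size x ^ (e + k)" for x
    using mult_le_mono[OF C D, of x x] by (simp add: power_add mult_ac)
  then show ?thesis unfolding poly_bounded_def by blast
qed

lemma poly_bounded_power:
  "poly_bounded g \<Longrightarrow> poly_bounded (\<lambda>x. g x ^ n)"
  by (induction n) (simp_all add: poly_bounded_const poly_bounded_mult)

lemmas poly_bounded_intros = poly_bounded_const poly_bounded_data_size poly_bounded_add
  poly_bounded_mult poly_bounded_power

lemma poly_bounded_comp:
  assumes "poly_bounded h" "poly_bounded (\<lambda>x. data_size (f x))"
  shows "poly_bounded (\<lambda>x. h (f x))"
proof -
  obtain C e where C: "\<And>x. h x \<le> C * data_size x ^ e"
    using assms unfolding poly_bounded_def by blast
  show ?thesis
    by (rule poly_bounded_mono[of "\<lambda>x. C * data_size (f x) ^ e"])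
      (intro poly_bounded_intros assms(2) C)+
qed


section \<open>Functions computable in polynomial time\<close>

primrec expr_bound :: "expr \<Rightarrow> nat" where
  "expr_bound (Var x) = Suc x"
| "expr_bound ENil = 0"
| "expr_bound (ECons e f) = max (expr_bound e) (expr_bound f)"
| "expr_bound (EHd e) = expr_bound e"
| "expr_bound (ETl e) = expr_bound e"

primrec var_bound :: "prog \<Rightarrow> nat" where
  "var_bound Skip = 0"
| "var_bound (Assign x e) = max (Suc x) (expr_bound e)"
| "var_bound (Seq p q) = max (var_bound p) (var_bound q)"
| "var_bound (Cond e p q) = max (expr_bound e) (max (var_bound p) (var_bound q))"
| "var_bound (While e p) = max (expr_bound e) (var_bound p)"

lemma exec_unchanged: "exec p s t s' \<Longrightarrow> var_bound p \<le> x \<Longrightarrow> s' x = s x"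
  by (induction rule: exec.induct) auto

text \<open>
  Since trees are shared, a program can produce an output of size exponential in its running time;
  the size of the output therefore has to be bounded separately.
\<close>

definition poly_time :: "(data \<Rightarrow> data) \<Rightarrow> bool" where
  "poly_time f \<longleftrightarrow> poly_bounded (\<lambda>x. data_size (f x)) \<and>
    (\<exists>p T. poly_bounded T \<and> (\<forall>s. \<exists>t s'. exec p s t s' \<and> s' 0 = f (s 0) \<and> t \<le> T (s 0)))"

lemma poly_time_size: "poly_time f \<Longrightarrow> poly_bounded (\<lambda>x. data_size (f x))"
  by (simp add: poly_time_def)

text \<open>Variables from \<open>var_bound p\<close> on survive a run of \<open>p\<close>. They
  serve as registers that keep values across a call.\<close>

lemma poly_timeE:
  assumes "poly_time f"
  obtains p T where "poly_bounded T"
    "\<And>s. \<exists>t s'. exec p s t s' \<and> s' 0 = f (s 0) \<and> t \<le> T (s 0) \<and> (\<forall>x\<ge>var_bound p. s' x = s x)"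
proof -
  obtain p T where "poly_bounded T" "\<And>s. \<exists>t s'. exec p s t s' \<and> s' 0 = f (s 0) \<and> t \<le> T (s 0)"
    using assms unfolding poly_time_def by blast
  then show thesis using that[of T p] exec_unchanged[of p] by meson
qed

lemma exec_AssignI: "t = 1 + expr_cost e \<Longrightarrow> s' = s(x := eval_expr e s) \<Longrightarrow> exec (Assign x e) s t s'"
  using exec_Assign by simp

lemma poly_time_id: "poly_time (\<lambda>x. x)"
  unfolding poly_time_def
  by (intro conjI exI[of _ Skip] exI[of _ "\<lambda>_. 1"] allI poly_bounded_intros)
    (use exec_Skip in fastforce)

lemma poly_time_Atom: "poly_time (\<lambda>x. Atom)"
  unfolding poly_time_def
  by (intro conjI exI[of _ "Assign 0 ENil"] exI[of _ "\<lambda>_. 2"] allI)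
    (auto intro!: exI exec_AssignI poly_bounded_intros)

lemma poly_time_fst_data_self: "poly_time fst_data"
  unfolding poly_time_def
proof (intro conjI exI[of _ "Assign 0 (EHd (Var 0))"] exI[of _ "\<lambda>_. 3"] allI)
  have "data_size (fst_data x) \<le> data_size x" for x by (cases x) auto
  then show "poly_bounded (\<lambda>x. data_size (fst_data x))"
    by (rule poly_bounded_mono[OF poly_bounded_data_size])
qed (auto intro!: exI exec_AssignI poly_bounded_intros)

lemma poly_time_snd_data_self: "poly_time snd_data"
  unfolding poly_time_def
proof (intro conjI exI[of _ "Assign 0 (ETl (Var 0))"] exI[of _ "\<lambda>_. 3"] allI)
  have "data_size (snd_data x) \<le> data_size x" for x by (cases x) auto
  then show "poly_bounded (\<lambda>x. data_size (snd_data x))"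
    by (rule poly_bounded_mono[OF poly_bounded_data_size])
qed (auto intro!: exI exec_AssignI poly_bounded_intros)

text \<open>The second program is timed in the size of \<open>f x\<close>; the output-size clause of
  \<open>poly_time\<close> is what turns this into a bound in the size of \<open>x\<close>.\<close>

lemma poly_time_comp:
  assumes "poly_time g" "poly_time f"
  shows "poly_time (\<lambda>x. g (f x))"
proof -
  obtain p T where T: "poly_bounded T" and
    p: "\<And>s. \<exists>t s'. exec p s t s' \<and> s' 0 = f (s 0) \<and> t \<le> T (s 0) \<and> (\<forall>x\<ge>var_bound p. s' x = s x)"
    by (rule poly_timeE[OF assms(2)], rule that)
  obtain q T' where T': "poly_bounded T'" and
    q: "\<And>s. \<exists>t s'. exec q s t s' \<and> s' 0 = g (s 0) \<and> t \<le> T' (s 0) \<and> (\<forall>x\<ge>var_bound q. s' x = s x)"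
    by (rule poly_timeE[OF assms(1)], rule that)
  note sf = poly_time_size[OF assms(2)]
  show ?thesis
    unfolding poly_time_def
  proof (intro conjI exI[of _ "Seq p q"] exI[of _ "\<lambda>x. T x + T' (f x)"] allI)
    show "poly_bounded (\<lambda>x. data_size (g (f x)))"
      using poly_bounded_comp[OF poly_time_size[OF assms(1)] sf] .
    show "poly_bounded (\<lambda>x. T x + T' (f x))"
      using T poly_bounded_comp[OF T' sf] by (rule poly_bounded_add)
    fix s :: store
    obtain t s' where 1: "exec p s t s'" "s' 0 = f (s 0)" "t \<le> T (s 0)" using p[of s] by blast
    obtain u s'' where 2: "exec q s' u s''" "s'' 0 = g (s' 0)" "u \<le> T' (s' 0)" using q[of s'] by blast
    show "\<exists>t s'. exec (Seq p q) s t s' \<and> s' 0 = g (f (s 0)) \<and> t \<le> T (s 0) + T' (f (s 0))"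
      using exec_Seq[OF 1(1) 2(1)] 1 2 by (intro exI[of _ "t + u"] exI[of _ s'']) auto
  qed
qed

lemmas poly_time_fst_data = poly_time_comp[OF poly_time_fst_data_self]
lemmas poly_time_snd_data = poly_time_comp[OF poly_time_snd_data_self]

lemma poly_time_Pair:
  assumes "poly_time f" "poly_time g"
  shows "poly_time (\<lambda>x. Pair (f x) (g x))"
proof -
  obtain p T where T: "poly_bounded T" and
    p: "\<And>s. \<exists>t s'. exec p s t s' \<and> s' 0 = f (s 0) \<and> t \<le> T (s 0) \<and> (\<forall>x\<ge>var_bound p. s' x = s x)"
    by (rule poly_timeE[OF assms(1)], rule that)
  obtain q T' where T': "poly_bounded T'" and
    q: "\<And>s. \<exists>t s'. exec q s t s' \<and> s' 0 = g (s 0) \<and> t \<le> T' (s 0) \<and> (\<forall>x\<ge>var_bound q. s' x = s x)"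
    by (rule poly_timeE[OF assms(2)], rule that)
  \<comment> \<open>Both programs overwrite variable 0, so the input is saved in \<open>N\<close>
    and the first result in \<open>Suc N\<close>. The \<open>Suc\<close> keeps \<open>N\<close>
    different from 0 even if both bounds are 0.\<close>
  define N where "N = Suc (var_bound p + var_bound q)"
  define r where "r = Seq (Assign N (Var 0)) (Seq p (Seq (Assign (Suc N) (Var 0))
     (Seq (Assign 0 (Var N)) (Seq q (Assign 0 (ECons (Var (Suc N)) (Var 0)))))))"
  have N: "var_bound p \<le> N" "var_bound q \<le> N" "var_bound q \<le> Suc N" "0 < N" by (auto simp: N_def)
  show ?thesis
    unfolding poly_time_def
  proof (intro conjI exI[of _ r] exI[of _ "\<lambda>x. T x + T' x + 10"] allI)
    show "poly_bounded (\<lambda>x. data_size (Pair (f x) (g x)))"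
      unfolding data_size.simps by (intro poly_bounded_intros poly_time_size assms)
    show "poly_bounded (\<lambda>x. T x + T' x + 10)"
      by (intro poly_bounded_intros T T')
    fix s :: store
    obtain t s' where 1: "exec p (s(N := s 0)) t s'" "s' 0 = f (s 0)" "t \<le> T (s 0)" "s' N = s 0"
      using p[of "s(N := s 0)"] N by auto
    define s2 where "s2 = s'(Suc N := s' 0, 0 := s 0)"
    obtain u s'' where 2: "exec q s2 u s''" "s'' 0 = g (s 0)" "u \<le> T' (s 0)" "s'' (Suc N) = f (s 0)"
      using q[of s2] N 1 by (auto simp: s2_def)
    have "exec (Assign N (Var 0)) s 2 (s(N := s 0))"
      "exec (Assign (Suc N) (Var 0)) s' 2 (s'(Suc N := s' 0))"
      "exec (Assign 0 (Var N)) (s'(Suc N := s' 0)) 2 s2"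
      using 1 by (auto intro!: exec_AssignI simp: s2_def)
    moreover have "exec (Assign 0 (ECons (Var (Suc N)) (Var 0))) s'' 4 (s''(0 := Pair (f (s 0)) (g (s 0))))"
      using 2 by (auto intro!: exec_AssignI)
    ultimately have "exec r s (2 + (t + (2 + (2 + (u + 4))))) (s''(0 := Pair (f (s 0)) (g (s 0))))"
      unfolding r_def using 1(1) 2(1) by (blast intro: exec_Seq)
    then show "\<exists>t s'. exec r s t s' \<and> s' 0 = Pair (f (s 0)) (g (s 0)) \<and> t \<le> T (s 0) + T' (s 0) + 10"
      using 1 2 by (intro exI[of _ "2 + (t + (2 + (2 + (u + 4))))"] exI[of _ "s''(0 := Pair (f (s 0)) (g (s 0)))"]) auto
  qed
qed

lemma poly_time_if:
  assumes "poly_time f" "poly_time g" "poly_time h"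
  shows "poly_time (\<lambda>x. if f x = Atom then h x else g x)"
proof -
  obtain p T where T: "poly_bounded T" and
    p: "\<And>s. \<exists>t s'. exec p s t s' \<and> s' 0 = f (s 0) \<and> t \<le> T (s 0) \<and> (\<forall>x\<ge>var_bound p. s' x = s x)"
    by (rule poly_timeE[OF assms(1)], rule that)
  obtain q T' where T': "poly_bounded T'" and
    q: "\<And>s. \<exists>t s'. exec q s t s' \<and> s' 0 = g (s 0) \<and> t \<le> T' (s 0) \<and> (\<forall>x\<ge>var_bound q. s' x = s x)"
    by (rule poly_timeE[OF assms(2)], rule that)
  obtain r T'' where T'': "poly_bounded T''" and
    r: "\<And>s. \<exists>t s'. exec r s t s' \<and> s' 0 = h (s 0) \<and> t \<le> T'' (s 0) \<and> (\<forall>x\<ge>var_bound r. s' x = s x)"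
    by (rule poly_timeE[OF assms(3)], rule that)
  define N where "N = Suc (var_bound p)"
  define c where "c = Seq (Assign N (Var 0)) (Seq p (Seq (Assign (Suc N) (Var 0))
     (Seq (Assign 0 (Var N)) (Cond (Var (Suc N)) q r))))"
  have N: "var_bound p \<le> N" "0 < N" by (auto simp: N_def)
  show ?thesis
    unfolding poly_time_def
  proof (intro conjI exI[of _ c] exI[of _ "\<lambda>x. T x + T' x + T'' x + 10"] allI)
    show "poly_bounded (\<lambda>x. data_size (if f x = Atom then h x else g x))"
      by (rule poly_bounded_mono[OF poly_bounded_add[OF poly_time_size[OF assms(2)] poly_time_size[OF assms(3)]]])
        auto
    show "poly_bounded (\<lambda>x. T x + T' x + T'' x + 10)"
      by (intro poly_bounded_intros T T' T'')
    fix s :: store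
    obtain t s' where 1: "exec p (s(N := s 0)) t s'" "s' 0 = f (s 0)" "t \<le> T (s 0)" "s' N = s 0"
      using p[of "s(N := s 0)"] N by auto
    define s2 where "s2 = s'(Suc N := s' 0, 0 := s 0)"
    have s2: "s2 0 = s 0" "s2 (Suc N) = f (s 0)" using 1 by (auto simp: s2_def)
    obtain u s'' where 2: "exec (Cond (Var (Suc N)) q r) s2 (2 + u) s''"
      "s'' 0 = (if f (s 0) = Atom then h (s 0) else g (s 0))" "u \<le> T' (s 0) + T'' (s 0)"
    proof (cases "f (s 0) = Atom")
      case True
      obtain u s'' where "exec r s2 u s''" "s'' 0 = h (s 0)" "u \<le> T'' (s 0)"
        using r[of s2] s2 by auto
      then show ?thesis using exec_Cond_false[of "Var (Suc N)" s2 r u s'' q] True s2 that[of u s''] by simp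
    next
      case False
      obtain u s'' where "exec q s2 u s''" "s'' 0 = g (s 0)" "u \<le> T' (s 0)"
        using q[of s2] s2 by auto
      then show ?thesis using exec_Cond_true[of "Var (Suc N)" s2 q u s'' r] False s2 that[of u s''] by simp
    qed
    have "exec (Assign N (Var 0)) s 2 (s(N := s 0))"
      "exec (Assign (Suc N) (Var 0)) s' 2 (s'(Suc N := s' 0))"
      "exec (Assign 0 (Var N)) (s'(Suc N := s' 0)) 2 s2"
      using 1 by (auto intro!: exec_AssignI simp: s2_def)
    then have "exec c s (2 + (t + (2 + (2 + (2 + u))))) s''"
      unfolding c_def using 1(1) 2(1) by (blast intro: exec_Seq)
    then show "\<exists>t s'. exec c s t s' \<and> s' 0 = (if f (s 0) = Atom then h (s 0) else g (s 0)) \<and>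
        t \<le> T (s 0) + T' (s 0) + T'' (s 0) + 10"
      using 1 2 by (intro exI[of _ "2 + (t + (2 + (2 + (2 + u))))"] exI[of _ s'']) auto
  qed
qed

section \<open>Loops over lists, expressed as left folds\<close>

primrec dlist :: "data \<Rightarrow> data list" where
  "dlist Atom = []"
| "dlist (Pair a b) = a # dlist b"

lemma length_dlist: "length (dlist x) < data_size x"
  by (induction x) auto

lemma data_size_mem_dlist: "a \<in> set (dlist x) \<Longrightarrow> data_size a < data_size x"
  by (induction x) auto

text \<open>The increment \<open>W\<close> may depend on the element and on the context, but not on
  the accumulator. This excludes steps such as \<open>Pair acc acc\<close>, whose iteration would
  produce exponentially large trees.\<close>

definition grows :: "(data \<Rightarrow> data \<Rightarrow> data \<Rightarrow> data) \<Rightarrow> bool" where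
  "grows G \<longleftrightarrow> (\<exists>W. poly_bounded W \<and>
     (\<forall>x a acc. data_size (G x a acc) \<le> data_size acc + W (Pair a x)))"

lemma growsI:
  assumes "poly_bounded W" "\<And>x a acc. data_size (G x a acc) \<le> data_size acc + W (Pair a x)"
  shows "grows G"
  using assms unfolding grows_def by blast

lemma data_size_fold:
  assumes "\<And>a acc. a \<in> set as \<Longrightarrow> data_size (F a acc) \<le> data_size acc + w"
  shows "data_size (fold F as acc) \<le> data_size acc + length as * w"
  using assms
proof (induction as arbitrary: acc)
  case (Cons a as)
  have "data_size (fold F as (F a acc)) \<le> data_size (F a acc) + length as * w"
    using Cons by simp
  also have "data_size (F a acc) \<le> data_size acc + w" using Cons by simp
  finally show ?case by simp
qed simp

text \<open>Variable \<open>N\<close> holds the unread rest of the list, \<open>Suc N\<close> the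
  context \<open>x\<close>, and 0 the accumulator; the body receives them packed as
  \<open>Pair a (Pair acc x)\<close>. The bound \<open>A\<close> is demanded for the fold over every
  prefix because each intermediate accumulator is an input of the body. The 20 is slack for the 12
  steps of bookkeeping per round.\<close>

lemma exec_fold_loop:
  fixes x :: data
  assumes p: "\<And>s. \<exists>t s'. exec p s t s' \<and> s' 0 = G (snd_data (snd_data (s 0))) (fst_data (s 0)) (fst_data (snd_data (s 0)))
       \<and> t \<le> T (s 0) \<and> (\<forall>x\<ge>var_bound p. s' x = s x)"
    and N: "N = Suc (var_bound p)"
    and K: "\<And>a acc. data_size a \<le> n \<Longrightarrow> data_size acc \<le> A \<Longrightarrow> T (Pair a (Pair acc x)) \<le> K"
    and r: "r = While (Var N) (Seq (Assign 0 (ECons (EHd (Var N)) (ECons (Var 0) (Var (Suc N)))))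
              (Seq p (Assign N (ETl (Var N)))))"
  shows "s N = L \<Longrightarrow> s (Suc N) = x \<Longrightarrow> data_size L \<le> n \<Longrightarrow>
     (\<And>as bs. dlist L = as @ bs \<Longrightarrow> data_size (fold (G x) as (s 0)) \<le> A) \<Longrightarrow>
     \<exists>t s'. exec r s t s' \<and> s' 0 = fold (G x) (dlist L) (s 0) \<and> t \<le> length (dlist L) * (K + 20) + 2"
proof (induction L arbitrary: s)
  case Atom
  then have "exec r s (1 + expr_cost (Var N)) s" unfolding r by (intro exec_While_false) simp
  then show ?case using Atom by (intro exI conjI) auto
next
  case (Pair a L)
  define s1 where "s1 = s(0 := Pair a (Pair (s 0) x))"
  obtain t s2 where 1: "exec p s1 t s2" "s2 0 = G x a (s 0)" "t \<le> T (Pair a (Pair (s 0) x))"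
    "s2 N = Pair a L" "s2 (Suc N) = x"
    using p[of s1] Pair.prems by (auto simp: s1_def N)
  define s3 where "s3 = s2(N := L)"
  have a: "data_size a \<le> n" using Pair.prems by simp
  have t: "t \<le> K" using 1(3) K[of a "s 0"] Pair.prems(4)[of "[]"] a by simp
  have "data_size (fold (G x) as (s3 0)) \<le> A" if "dlist L = as @ bs" for as bs
    using Pair.prems(4)[of "a # as" bs] that 1 by (simp add: s3_def N)
  then have "\<exists>t s'. exec r s3 t s' \<and> s' 0 = fold (G x) (dlist L) (s3 0) \<and> t \<le> length (dlist L) * (K + 20) + 2"
    using Pair.prems 1 by (intro Pair.IH) (auto simp: s3_def)
  then obtain u s' where 2: "exec r s3 u s'" "s' 0 = fold (G x) (dlist L) (s3 0)"
    "u \<le> length (dlist L) * (K + 20) + 2" by blast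
  have "exec (Assign 0 (ECons (EHd (Var N)) (ECons (Var 0) (Var (Suc N))))) s 7 s1"
    "exec (Assign N (ETl (Var N))) s2 3 s3"
    using Pair.prems 1 by (auto intro!: exec_AssignI simp: s1_def s3_def)
  then have "exec (Seq (Assign 0 (ECons (EHd (Var N)) (ECons (Var 0) (Var (Suc N)))))
              (Seq p (Assign N (ETl (Var N))))) s (7 + (t + 3)) s3"
    using 1(1) by (blast intro: exec_Seq)
  then have "exec r s (1 + expr_cost (Var N) + (7 + (t + 3)) + u) s'"
    using 2 Pair.prems unfolding r by (intro exec_While_true) auto
  moreover have "s3 0 = G x a (s 0)" using 1 by (simp add: s3_def N)
  ultimately show ?case
    using 2 t by (intro exI[of _ "1 + expr_cost (Var N) + (7 + (t + 3)) + u"] exI[of _ s']) auto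
qed

text \<open>The explicit bound \<open>A\<close> serves the loop in \<open>dindexed\<close>: it
  copies its counter into the output, so its growth depends on the accumulator and
  \<open>grows\<close> does not apply.\<close>

lemma poly_time_fold_bounded:
  assumes G: "poly_time (\<lambda>z. G (snd_data (snd_data z)) (fst_data z) (fst_data (snd_data z)))"
    and l: "poly_time l" and a: "poly_time a" and A: "poly_bounded A"
    and bound: "\<And>x as bs. dlist (l x) = as @ bs \<Longrightarrow> data_size (fold (G x) as (a x)) \<le> A x"
  shows "poly_time (\<lambda>x. fold (G x) (dlist (l x)) (a x))"
proof -
  obtain p T where T: "poly_bounded T" and
    p: "\<And>s. \<exists>t s'. exec p s t s' \<and> s' 0 = G (snd_data (snd_data (s 0))) (fst_data (s 0)) (fst_data (snd_data (s 0)))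
       \<and> t \<le> T (s 0) \<and> (\<forall>x\<ge>var_bound p. s' x = s x)"
    by (rule poly_timeE[OF G], rule that)
  obtain p' T' where T': "poly_bounded T'" and
    p': "\<And>s. \<exists>t s'. exec p' s t s' \<and> s' 0 = Pair (l (s 0)) (Pair (a (s 0)) (s 0))
       \<and> t \<le> T' (s 0) \<and> (\<forall>x\<ge>var_bound p'. s' x = s x)"
    by (rule poly_timeE[OF poly_time_Pair[OF l poly_time_Pair[OF a poly_time_id]]], rule that)
  \<comment> \<open>\<open>T\<close> may fail to be monotone; a monomial in the size is monotone, so
    it can be evaluated at upper bounds.\<close>
  obtain C e where C: "\<And>x. T x \<le> C * data_size x ^ e" using T unfolding poly_bounded_def by blast
  \<comment> \<open>The 2 counts the two inner nodes of \<open>Pair b (Pair acc x)\<close>.\<close>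
  define K where "K x = C * (2 + data_size (l x) + A x + data_size x) ^ e" for x
  note pl = poly_time_size[OF l]
  have pK: "poly_bounded K" unfolding K_def by (intro poly_bounded_intros A pl)
  have K: "T (Pair b (Pair acc x)) \<le> K x"
    if "data_size b \<le> data_size (l x)" "data_size acc \<le> A x" for x b acc
  proof -
    have "T (Pair b (Pair acc x)) \<le> C * data_size (Pair b (Pair acc x)) ^ e" using C .
    also have "\<dots> \<le> K x" unfolding K_def using that by (intro mult_le_mono power_mono) auto
    finally show ?thesis .
  qed
  define N where "N = Suc (var_bound p)"
  define r where "r = While (Var N) (Seq (Assign 0 (ECons (EHd (Var N)) (ECons (Var 0) (Var (Suc N)))))
              (Seq p (Assign N (ETl (Var N)))))"
  define c where "c = Seq p' (Seq (Assign N (EHd (Var 0))) (Seq (Assign (Suc N) (ETl (ETl (Var 0))))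
                  (Seq (Assign 0 (EHd (ETl (Var 0)))) r)))"
  show ?thesis
    unfolding poly_time_def
  proof (intro conjI exI[of _ c] exI[of _ "\<lambda>x. T' x + data_size (l x) * (K x + 20) + 20"] allI)
    have "data_size (fold (G x) (dlist (l x)) (a x)) \<le> A x" for x
      using bound[of x "dlist (l x)" "[]"] by simp
    then show "poly_bounded (\<lambda>x. data_size (fold (G x) (dlist (l x)) (a x)))"
      by (rule poly_bounded_mono[OF A])
    show "poly_bounded (\<lambda>x. T' x + data_size (l x) * (K x + 20) + 20)"
      by (intro poly_bounded_intros pK T' pl)
    fix s :: store
    define x where "x = s 0"
    obtain t' s0 where 0: "exec p' s t' s0" "s0 0 = Pair (l x) (Pair (a x) x)" "t' \<le> T' x"
      using p'[of s] by (auto simp: x_def)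
    define s1 where "s1 = s0(N := l x, Suc N := x, 0 := a x)"
    have "\<exists>t s'. exec r s1 t s' \<and> s' 0 = fold (G x) (dlist (l x)) (s1 0) \<and>
       t \<le> length (dlist (l x)) * (K x + 20) + 2"
      using bound[of x] by (intro exec_fold_loop[OF p N_def K r_def]) (auto simp: s1_def N_def)
    then obtain t s' where 1: "exec r s1 t s'" "s' 0 = fold (G x) (dlist (l x)) (a x)"
       "t \<le> length (dlist (l x)) * (K x + 20) + 2"
      by (auto simp: s1_def)
    have "exec (Assign N (EHd (Var 0))) s0 3 (s0(N := l x))"
      "exec (Assign (Suc N) (ETl (ETl (Var 0)))) (s0(N := l x)) 4 (s0(N := l x, Suc N := x))"
      "exec (Assign 0 (EHd (ETl (Var 0)))) (s0(N := l x, Suc N := x)) 4 s1"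
      by (auto intro!: exec_AssignI simp: s1_def 0 N_def)
    then have "exec c s (t' + (3 + (4 + (4 + t)))) s'"
      unfolding c_def using 0(1) 1(1) by (blast intro: exec_Seq)
    moreover have "t \<le> data_size (l x) * (K x + 20) + 2"
      by (rule order_trans[OF 1(3)], intro add_mono mult_le_mono)
        (use length_dlist[of "l x"] in auto)
    ultimately show "\<exists>t s'. exec c s t s' \<and> s' 0 = fold (G (s 0)) (dlist (l (s 0))) (a (s 0)) \<and>
         t \<le> T' (s 0) + data_size (l (s 0)) * (K (s 0) + 20) + 20"
      using 0 1 by (intro exI[of _ "t' + (3 + (4 + (4 + t)))"] exI[of _ s']) (auto simp: x_def)
  qed
qed

lemma poly_time_fold:
  assumes G: "poly_time (\<lambda>z. G (snd_data (snd_data z)) (fst_data z) (fst_data (snd_data z)))"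
    and "grows G" and l: "poly_time l" and a: "poly_time a"
  shows "poly_time (\<lambda>x. fold (G x) (dlist (l x)) (a x))"
proof -
  obtain W where W: "poly_bounded W" "\<And>x a acc. data_size (G x a acc) \<le> data_size acc + W (Pair a x)"
    using \<open>grows G\<close> unfolding grows_def by blast
  obtain D k where D: "\<And>x. W x \<le> D * data_size x ^ k" using W(1) unfolding poly_bounded_def by blast
  define w where "w x = D * (1 + data_size (l x) + data_size x) ^ k" for x
  show ?thesis
  proof (rule poly_time_fold_bounded[where A = "\<lambda>x. data_size (a x) + data_size (l x) * w x"])
    show "poly_bounded (\<lambda>x. data_size (a x) + data_size (l x) * w x)"
      unfolding w_def by (intro poly_bounded_intros poly_time_size l a)
    fix x as bs assume as: "dlist (l x) = as @ bs"
    have "data_size (G x b acc) \<le> data_size acc + w x" if "b \<in> set as" for b acc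
    proof -
      have "data_size b < data_size (l x)" using that as data_size_mem_dlist[of b "l x"] by simp
      then have "D * data_size (Pair b x) ^ k \<le> w x"
        unfolding w_def by (intro mult_le_mono power_mono) auto
      then show ?thesis using W(2)[of x b acc] D[of "Pair b x"] by linarith
    qed
    then have "data_size (fold (G x) as (a x)) \<le> data_size (a x) + length as * w x"
      by (rule data_size_fold)
    also have "\<dots> \<le> data_size (a x) + data_size (l x) * w x"
      using length_dlist[of "l x"] as by (intro add_mono mult_le_mono) auto
    finally show "data_size (fold (G x) as (a x)) \<le> data_size (a x) + data_size (l x) * w x" .
  qed (fact G l a)+
qed

section \<open>The reduction as a function on trees\<close>

lemma poly_time_const: "poly_time (\<lambda>x. d)"
  by (induction d) (auto intro: poly_time_Atom poly_time_Pair)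

lemmas poly_time_intros = poly_time_id poly_time_const poly_time_fst_data poly_time_snd_data
  poly_time_Pair poly_time_if

lemma grows_Pair:
  assumes "poly_time (\<lambda>z. h (snd_data z) (fst_data z))"
  shows "grows (\<lambda>x a acc. Pair (h x a) acc)"
  using poly_bounded_add[OF poly_bounded_const poly_time_size[OF assms], of 1]
  by (rule growsI) simp

definition drev :: "data \<Rightarrow> data \<Rightarrow> data" where
  "drev d acc = fold Pair (dlist d) acc"

lemma drev_simps [simp]: "drev Atom acc = acc" "drev (Pair a d) acc = drev d (Pair a acc)"
  by (simp_all add: drev_def)

lemma poly_time_drev: "poly_time f \<Longrightarrow> poly_time g \<Longrightarrow> poly_time (\<lambda>x. drev (f x) (g x))"
  unfolding drev_def
  by (intro poly_time_fold[where G = "\<lambda>x a acc. Pair a acc"] grows_Pair poly_time_intros)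

section \<open>Increment, equality and membership for binary numerals\<close>

abbreviation one :: data where "one \<equiv> Pair Atom Atom"

primrec dinc :: "data \<Rightarrow> data" where
  "dinc Atom = Pair one Atom"
| "dinc (Pair b d) = (if b = Atom then Pair one d else Pair Atom (dinc d))"

lemma enc_nat_0 [simp]: "enc_nat 0 = Atom"
  by (simp add: enc_nat.simps)

lemma dinc_enc_nat [simp]: "dinc (enc_nat n) = enc_nat (Suc n)"
proof (induction n rule: less_induct)
  case (less n)
  show ?case
  proof (cases "n = 0")
    case True
    then show ?thesis by (simp add: enc_nat.simps[of "Suc 0"])
  next
    case False
    then have "dinc (enc_nat (n div 2)) = enc_nat (Suc (n div 2))" by (intro less) simp
    then show ?thesis using False
      by (simp add: enc_nat.simps[of n] enc_nat.simps[of "Suc n"])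
  qed
qed

lemma data_size_dinc: "data_size (dinc d) \<le> data_size d + 4"
proof (induction d)
  case (Pair b d)
  then show ?case by (cases b) auto
qed simp

text \<open>\<open>dinc\<close> recurses to the end of the list, whereas loops are left folds. The
  fold state consists of a carry flag and the bits already produced, latest first;
  \<open>carry_out\<close> then adds a leftover carry as the top bit and reverses.\<close>

definition carry_step :: "data \<Rightarrow> data \<Rightarrow> data" where
  "carry_step b acc = (if fst_data acc = Atom then Pair Atom (Pair b (snd_data acc))
     else if b = Atom then Pair Atom (Pair one (snd_data acc))
     else Pair one (Pair Atom (snd_data acc)))"

lemma carry_step_Pair:
  "carry_step b (Pair c out) = (if c = Atom then Pair Atom (Pair b out)
     else if b = Atom then Pair Atom (Pair one out) else Pair one (Pair Atom out))"
  by (simp add: carry_step_def)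

definition carry_out :: "data \<Rightarrow> data" where
  "carry_out r = drev (if fst_data r = Atom then snd_data r else Pair one (snd_data r)) Atom"

text \<open>The carry and the produced bits are arbitrary so that the induction goes through:
  without a carry the remaining bits are copied, with a carry they are incremented.\<close>

lemma carry_out_fold:
  "carry_out (fold carry_step (dlist d) (Pair c out)) = drev out (if c = Atom then d else dinc d)"
proof (induction d arbitrary: c out)
  case (Pair b d)
  show ?case by (simp add: carry_step_Pair Pair(2))
qed (simp add: carry_out_def)

lemma poly_time_dinc: "poly_time f \<Longrightarrow> poly_time (\<lambda>x. dinc (f x))"
proof (rule poly_time_comp[where g = dinc])
  have "grows (\<lambda>x. carry_step)"
  proof (rule growsI)
    fix x a acc
    show "data_size (carry_step a acc) \<le> data_size acc + (data_size (Pair a x) + 10)"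
      by (cases acc) (auto simp: carry_step_def)
  qed (intro poly_bounded_intros)
  moreover have "poly_time (\<lambda>z. carry_step (fst_data z) (fst_data (snd_data z)))"
    unfolding carry_step_def by (intro poly_time_intros)
  ultimately have *: "poly_time (\<lambda>d. fold carry_step (dlist d) (Pair one Atom))"
    by (intro poly_time_fold[where G = "\<lambda>x. carry_step"] poly_time_intros)
  have dinc: "dinc = (\<lambda>d. carry_out (fold carry_step (dlist d) (Pair one Atom)))"
    using carry_out_fold[of _ one Atom] by (auto simp: fun_eq_iff)
  show "poly_time dinc"
    unfolding dinc carry_out_def by (intro poly_time_intros poly_time_drev *)
qed

text \<open>The fold runs over the bits of the first numeral; its state is a flag for agreement so
  far, paired with the unread rest of the second numeral. Bits are compared only by whether they are
  \<open>Atom\<close>, so \<open>deq\<close> decides equality of numerals, not of arbitrary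
  trees.\<close>

definition deq_step :: "data \<Rightarrow> data \<Rightarrow> data" where
  "deq_step a acc = Pair
     (if fst_data acc = Atom then Atom else if snd_data acc = Atom then Atom
      else if a = Atom then (if fst_data (snd_data acc) = Atom then one else Atom)
      else if fst_data (snd_data acc) = Atom then Atom else one)
     (snd_data (snd_data acc))"

definition deq :: "data \<Rightarrow> data \<Rightarrow> data" where
  "deq x y = (if snd_data (fold deq_step (dlist x) (Pair one y)) = Atom
     then fst_data (fold deq_step (dlist x) (Pair one y)) else Atom)"

lemma poly_time_deq: "poly_time f \<Longrightarrow> poly_time g \<Longrightarrow> poly_time (\<lambda>x. deq (f x) (g x))"
proof -
  assume fg: "poly_time f" "poly_time g"
  have "grows (\<lambda>x. deq_step)"
  proof (rule growsI)
    fix x a acc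
    have "data_size (snd_data (snd_data acc)) \<le> data_size acc"
      by (cases acc; cases "snd_data acc") auto
    then show "data_size (deq_step a acc) \<le> data_size acc + 10"
      by (auto simp: deq_step_def)
  qed (intro poly_bounded_intros)
  moreover have "poly_time (\<lambda>z. deq_step (fst_data z) (fst_data (snd_data z)))"
    unfolding deq_step_def by (intro poly_time_intros)
  ultimately have "poly_time (\<lambda>x. fold deq_step (dlist (f x)) (Pair one (g x)))"
    by (intro poly_time_fold[where G = "\<lambda>x. deq_step"] poly_time_intros fg)
  then show ?thesis unfolding deq_def by (intro poly_time_intros)
qed

lemma fold_deq_step_enc_nat:
  "let r = fold deq_step (dlist (enc_nat u)) (Pair c (enc_nat v)) in
     (snd_data r = Atom \<and> fst_data r \<noteq> Atom) \<longleftrightarrow> c \<noteq> Atom \<and> u = v"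
proof (induction u arbitrary: c v rule: less_induct)
  case (less u)
  show ?case
  proof (cases "u = 0")
    case True
    then show ?thesis by (simp add: enc_nat.simps[of v])
  next
    case False
    define c' where "c' = fst_data (deq_step (if even u then Atom else one) (Pair c (enc_nat v)))"
    have c': "c' \<noteq> Atom \<longleftrightarrow> c \<noteq> Atom \<and> v \<noteq> 0 \<and> (even u \<longleftrightarrow> even v)"
      by (simp add: c'_def deq_step_def enc_nat.simps[of v])
    have tl: "snd_data (enc_nat v) = enc_nat (v div 2)"
      by (cases "v = 0") (simp_all add: enc_nat.simps[of v])
    \<comment> \<open>One loop round checks the first two conjuncts: \<open>0\<close> is the only
      number coded by \<open>Atom\<close>, and the low bit is the parity. The third is the induction
      hypothesis.\<close>
    have "u = v \<longleftrightarrow> v \<noteq> 0 \<and> (even u \<longleftrightarrow> even v) \<and> u div 2 = v div 2" using False by presburger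
    moreover have "deq_step (if even u then Atom else one) (Pair c (enc_nat v)) = Pair c' (enc_nat (v div 2))"
      by (simp add: c'_def deq_step_def tl)
    ultimately show ?thesis
      using False less(1)[of "u div 2" c' "v div 2"] c' by (auto simp: enc_nat.simps[of u] Let_def)
  qed
qed

lemma deq_enc_nat [simp]: "deq (enc_nat u) (enc_nat v) = Atom \<longleftrightarrow> u \<noteq> v"
  using fold_deq_step_enc_nat[of u one v] by (auto simp: deq_def Let_def)

definition dmem :: "data \<Rightarrow> data \<Rightarrow> data" where
  "dmem u l = fold (\<lambda>a acc. if deq a u = Atom then acc else one) (dlist l) Atom"

lemma poly_time_dmem: "poly_time f \<Longrightarrow> poly_time g \<Longrightarrow> poly_time (\<lambda>x. dmem (f x) (g x))"
proof -
  assume fg: "poly_time f" "poly_time g"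
  have "grows (\<lambda>x a acc. if deq a (f x) = Atom then acc else one)"
    by (rule growsI[of "\<lambda>_. 3"]) (auto intro: poly_bounded_intros)
  then show ?thesis unfolding dmem_def
    by (intro poly_time_fold[where G = "\<lambda>x a acc. if deq a (f x) = Atom then acc else one"]
      poly_time_intros poly_time_deq fg poly_time_comp[OF fg(1)])
qed

lemma dlist_enc_list [simp]: "dlist (enc_list h xs) = map h xs"
  by (induction xs) auto

lemma dmem_enc_list [simp]: "dmem (enc_nat u) (enc_list enc_nat l) = Atom \<longleftrightarrow> u \<notin> set l"
proof -
  have "fold (\<lambda>a acc. if deq a (enc_nat u) = Atom then acc else one) (map enc_nat l) acc = Atom
     \<longleftrightarrow> acc = Atom \<and> u \<notin> set l" for acc
    by (induction l arbitrary: acc) auto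
  then show ?thesis by (simp add: dmem_def)
qed

text \<open>
  The capacity of an element is one more than the number of sets containing it, minus \<open>b\<close>,
  truncated at 0.  \<open>b\<close> may be exponential in the input size, so the difference is
  obtained by counting up to \<open>b\<close> before counting the result.
\<close>

definition tick :: "data \<Rightarrow> data \<Rightarrow> data" where
  "tick b st = (if deq (fst_data st) b = Atom then Pair (dinc (fst_data st)) (snd_data st)
     else Pair (fst_data st) (dinc (snd_data st)))"

definition dcap :: "data \<Rightarrow> data \<Rightarrow> data \<Rightarrow> data" where
  "dcap u LS b = snd_data (tick b
     (fold (\<lambda>l st. if dmem u l = Atom then st else tick b st) (dlist LS) (Pair Atom Atom)))"

lemma poly_time_tick: "poly_time f \<Longrightarrow> poly_time g \<Longrightarrow> poly_time (\<lambda>x. tick (f x) (g x))"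
  unfolding tick_def by (intro poly_time_intros poly_time_deq poly_time_dinc)

lemma data_size_tick: "data_size (tick b st) \<le> data_size st + 10"
  using data_size_dinc[of "fst_data st"] data_size_dinc[of "snd_data st"]
  by (cases st) (auto simp: tick_def)

lemma poly_time_dcap:
  assumes "poly_time f" "poly_time g" "poly_time h"
  shows "poly_time (\<lambda>x. dcap (f x) (g x) (h x))"
proof -
  have "grows (\<lambda>x l st. if dmem (f x) l = Atom then st else tick (h x) st)"
    by (rule growsI[of "\<lambda>_. 10"]) (auto intro: poly_bounded_intros data_size_tick)
  then have "poly_time (\<lambda>x. fold (\<lambda>l st. if dmem (f x) l = Atom then st else tick (h x) st)
       (dlist (g x)) (Pair Atom Atom))"
    by (intro poly_time_fold[where G = "\<lambda>x l st. if dmem (f x) l = Atom then st else tick (h x) st"]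
      poly_time_intros poly_time_dmem poly_time_tick assms
      poly_time_comp[OF assms(1)] poly_time_comp[OF assms(3)])
  then show ?thesis
    unfolding dcap_def by (intro poly_time_snd_data poly_time_tick assms)
qed

text \<open>After \<open>c\<close> ticks the state is \<open>min c b\<close> and
  \<open>c - b\<close>: the second counter starts once the first has reached \<open>b\<close>. The
  work thus depends on the number of ticks and on numeral lengths, not on the value of
  \<open>b\<close>.\<close>

lemma tick_enc_nat:
  "tick (enc_nat b) (Pair (enc_nat (min c b)) (enc_nat (c - b)))
    = Pair (enc_nat (min (Suc c) b)) (enc_nat (Suc c - b))"
  by (auto simp: tick_def min_def not_le Suc_diff_le)

lemma dcap_enc:
  "dcap (enc_nat u) (enc_list (enc_list enc_nat) ls) (enc_nat b)
    = enc_nat (Suc (length (filter (\<lambda>l. u \<in> set l) ls)) - b)"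
proof -
  have "fold (\<lambda>l st. if dmem (enc_nat u) l = Atom then st else tick (enc_nat b) st)
      (map (enc_list enc_nat) ls) (Pair (enc_nat (min c b)) (enc_nat (c - b)))
    = (let c' = c + length (filter (\<lambda>l. u \<in> set l) ls) in
        Pair (enc_nat (min c' b)) (enc_nat (c' - b)))" for c
    by (induction ls arbitrary: c) (auto simp: tick_enc_nat Let_def)
  from this[of 0] show ?thesis
    by (simp add: dcap_def Let_def tick_enc_nat)
qed


text \<open>Equal sets may occur repeatedly and need distinct vertices, so each set is labelled by
  its position. Prepending the bit \<open>one\<close> to the counter \<open>i\<close> gives the
  vertex number \<open>2 * i + 1\<close>. The list comes out in reverse order.\<close>

definition dindexed :: "data \<Rightarrow> data" where
  "dindexed LS = snd_data (fold (\<lambda>l acc. Pair (dinc (fst_data acc))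
     (Pair (Pair (Pair one (fst_data acc)) l) (snd_data acc))) (dlist LS) (Pair Atom Atom))"

text \<open>Two zero bits in front of \<open>u\<close> give \<open>4 * u\<close>. The result is a
  numeral without leading zeros only for \<open>u > 0\<close>, which holds because the universe
  starts at 1.\<close>

definition delem :: "data \<Rightarrow> data" where "delem u = Pair Atom (Pair Atom u)"
definition dleaf :: "data \<Rightarrow> data" where "dleaf u = Pair Atom (Pair one u)"

text \<open>The universe is written out in the input, so \<open>k + m\<close> is reached by one
  increment of \<open>k\<close> per listed element.\<close>

definition dbudget :: "data \<Rightarrow> data" where
  "dbudget d = fold (\<lambda>u acc. dinc acc) (dlist (fst_data d)) (snd_data (snd_data (snd_data d)))"

text \<open>Any capacity of at least \<open>m\<close> lets a set vertex serve all its edges; the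
  budget \<open>k + m\<close> is such a number and is already available.\<close>

definition dvertices :: "data \<Rightarrow> data" where
  "dvertices d =
    fold (\<lambda>u acc. Pair (Pair (dleaf u) Atom) acc) (dlist (fst_data d))
    (fold (\<lambda>u acc. Pair (Pair (delem u) (dcap u (fst_data (snd_data d)) (fst_data (snd_data (snd_data d))))) acc)
        (dlist (fst_data d))
    (fold (\<lambda>p acc. Pair (Pair (fst_data p) (dbudget d)) acc) (dlist (dindexed (fst_data (snd_data d)))) Atom))"

definition dedges :: "data \<Rightarrow> data" where
  "dedges d =
    fold (\<lambda>u acc. Pair (Pair (dleaf u) (delem u)) acc) (dlist (fst_data d))
    (fold (\<lambda>p acc. fold (\<lambda>u acc. Pair (Pair (fst_data p) (delem u)) acc) (dlist (snd_data p)) acc)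
       (dlist (dindexed (fst_data (snd_data d)))) Atom)"

definition reduction :: "data \<Rightarrow> data" where
  "reduction d = Pair (dvertices d) (Pair (dedges d) (dbudget d))"

text \<open>An increment adds at most 4 to the size of the counter, so every new entry has size
  linear in the number of rounds plus \<open>M\<close>. The conjunct \<open>r \<noteq> Atom\<close>
  allows the size of \<open>r\<close> to be split into its two components.\<close>

lemma dindexed_bound:
  assumes "\<And>l. l \<in> set as \<Longrightarrow> data_size l \<le> M"
  shows "let r = fold (\<lambda>l acc. Pair (dinc (fst_data acc))
     (Pair (Pair (Pair one (fst_data acc)) l) (snd_data acc))) as (Pair Atom Atom) in
     r \<noteq> Atom \<and> data_size (fst_data r) \<le> 1 + 4 * length as \<and>
     data_size (snd_data r) \<le> 1 + length as * (10 + 4 * length as + M)"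
  using assms
proof (induction as rule: rev_induct)
  case (snoc a as)
  define r where "r = fold (\<lambda>l acc. Pair (dinc (fst_data acc))
     (Pair (Pair (Pair one (fst_data acc)) l) (snd_data acc))) as (Pair Atom Atom)"
  have r: "data_size (fst_data r) \<le> 1 + 4 * length as"
     "data_size (snd_data r) \<le> 1 + length as * (10 + 4 * length as + M)" "data_size a \<le> M"
    using snoc by (auto simp: r_def Let_def)
  show ?case
    using r data_size_dinc[of "fst_data r"] by (simp add: r_def[symmetric] algebra_simps)
qed simp

lemma poly_time_dindexed: "poly_time f \<Longrightarrow> poly_time (\<lambda>x. dindexed (f x))"
proof -
  assume f: "poly_time f"
  have "poly_time (\<lambda>x. fold (\<lambda>l acc. Pair (dinc (fst_data acc))
     (Pair (Pair (Pair one (fst_data acc)) l) (snd_data acc))) (dlist (f x)) (Pair Atom Atom))"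
  proof (rule poly_time_fold_bounded[where A = "\<lambda>x. 3 + 4 * data_size (f x) +
        data_size (f x) * (10 + 4 * data_size (f x) + data_size (f x))"])
    fix x as bs
    assume as: "dlist (f x) = as @ bs"
    define r where "r = fold (\<lambda>l acc. Pair (dinc (fst_data acc))
      (Pair (Pair (Pair one (fst_data acc)) l) (snd_data acc))) as (Pair Atom Atom)"
    have n: "length as \<le> data_size (f x)" using length_dlist[of "f x"] as by simp
    have "r \<noteq> Atom \<and> data_size (fst_data r) \<le> 1 + 4 * length as \<and>
     data_size (snd_data r) \<le> 1 + length as * (10 + 4 * length as + data_size (f x))"
      using dindexed_bound[of as "data_size (f x)"] as data_size_mem_dlist[of _ "f x"]
      by (simp add: r_def Let_def) (meson Un_iff less_imp_le)
    moreover have "length as * (10 + 4 * length as + data_size (f x)) \<le>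
        data_size (f x) * (10 + 4 * data_size (f x) + data_size (f x))"
      using n by (intro mult_le_mono) auto
    ultimately show "data_size r \<le> 3 + 4 * data_size (f x) +
        data_size (f x) * (10 + 4 * data_size (f x) + data_size (f x))"
      using n by (cases r) auto
  qed (intro poly_time_intros poly_bounded_intros poly_time_dinc poly_time_size f)+
  then show ?thesis unfolding dindexed_def by (rule poly_time_snd_data)
qed

lemma poly_time_dbudget: "poly_time dbudget"
  unfolding dbudget_def
proof (rule poly_time_fold[where G = "\<lambda>x u acc. dinc acc"])
  show "grows (\<lambda>x u acc. dinc acc)"
    by (rule growsI[of "\<lambda>_. 4"]) (auto intro: poly_bounded_intros data_size_dinc)
qed (intro poly_time_intros poly_time_dinc)+

lemma poly_time_dvertices: "poly_time dvertices"
  unfolding dvertices_def delem_def dleaf_def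
  apply (rule poly_time_fold[where G = "\<lambda>x u acc. Pair (Pair (Pair Atom (Pair one u)) Atom) acc"])
     apply (intro poly_time_intros grows_Pair)+
  apply (rule poly_time_fold[where G = "\<lambda>d u acc. Pair (Pair (Pair Atom (Pair Atom u))
      (dcap u (fst_data (snd_data d)) (fst_data (snd_data (snd_data d))))) acc"])
     apply (intro poly_time_intros grows_Pair poly_time_dcap)+
  apply (rule poly_time_fold[where G = "\<lambda>d p acc. Pair (Pair (fst_data p) (dbudget d)) acc"])
  apply (intro poly_time_intros grows_Pair poly_time_dindexed poly_time_comp[OF poly_time_dbudget])+
  done

lemma poly_time_dedges: "poly_time dedges"
  unfolding dedges_def delem_def dleaf_def
proof (intro poly_time_fold[where G = "\<lambda>x u acc. Pair (Pair (Pair Atom (Pair one u)) (Pair Atom (Pair Atom u))) acc"]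
   poly_time_fold[where G = "\<lambda>x p acc. fold (\<lambda>u acc. Pair (Pair (fst_data p) (Pair Atom (Pair Atom u))) acc)
      (dlist (snd_data p)) acc"])
  \<comment> \<open>The inner loop runs with the packed argument \<open>z\<close> of the outer body
    as its context; the labelled set \<open>p\<close> is \<open>fst_data z\<close>.\<close>
  let ?H = "\<lambda>z u acc. Pair (Pair (fst_data (fst_data z)) (Pair Atom (Pair Atom u))) acc"
  show "poly_time (\<lambda>z. fold (\<lambda>u acc. Pair (Pair (fst_data (fst_data z)) (Pair Atom (Pair Atom u))) acc)
          (dlist (snd_data (fst_data z))) (fst_data (snd_data z)))"
    by (intro poly_time_fold[where G = ?H] poly_time_intros grows_Pair)
  \<comment> \<open>A whole inner loop adds fewer than \<open>data_size p\<close> entries, each of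
    size linear in that of \<open>p\<close>, whatever the accumulator is.\<close>
  show "grows (\<lambda>x p acc. fold (\<lambda>u acc. Pair (Pair (fst_data p) (Pair Atom (Pair Atom u))) acc)
      (dlist (snd_data p)) acc)"
  proof (rule growsI)
    fix x p acc :: data
    have p: "data_size (fst_data p) \<le> data_size p" "data_size (snd_data p) \<le> data_size p"
      by (cases p; simp)+
    have "data_size (fold (\<lambda>u acc. Pair (Pair (fst_data p) (Pair Atom (Pair Atom u))) acc)
        (dlist (snd_data p)) acc) \<le> data_size acc + length (dlist (snd_data p)) * (10 + data_size p + data_size p)"
    proof (rule data_size_fold)
      fix u acc assume "u \<in> set (dlist (snd_data p))"
      then show "data_size (Pair (Pair (fst_data p) (Pair Atom (Pair Atom u))) acc)
          \<le> data_size acc + (10 + data_size p + data_size p)"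
        using p data_size_mem_dlist[of u "snd_data p"] by simp
    qed
    also have "\<dots> \<le> data_size acc + data_size (Pair p x) * (10 + data_size (Pair p x) + data_size (Pair p x))"
      using p length_dlist[of "snd_data p"] by (intro add_mono mult_le_mono) auto
    finally show "data_size (fold (\<lambda>u acc. Pair (Pair (fst_data p) (Pair Atom (Pair Atom u))) acc)
        (dlist (snd_data p)) acc) \<le> data_size acc + data_size (Pair p x) * (10 + data_size (Pair p x) + data_size (Pair p x))" .
  qed (intro poly_bounded_intros)
qed (intro poly_time_intros grows_Pair poly_time_dindexed)+

lemma poly_time_reduction: "poly_time reduction"
  unfolding reduction_def
  by (intro poly_time_Pair poly_time_dvertices poly_time_dedges poly_time_dbudget)

section \<open>The graph of a Set Multicover instance\<close>

text \<open>
  The element \<open>u\<close> becomes the vertex \<open>4 * u\<close> with the pendant vertex \<open>4 * u + 2\<close>, and the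
  \<open>i\<close>-th set becomes the vertex \<open>2 * i + 1\<close>.
\<close>

definition multicover_edges :: "nat \<Rightarrow> nat set list \<Rightarrow> nat set set" where
  "multicover_edges m \<S> = (\<lambda>u. {4 * u + 2, 4 * u}) ` {1..m} \<union>
     {{2 * i + 1, 4 * u} | i u. i < length \<S> \<and> u \<in> \<S> ! i}"

definition multicover_vertices :: "nat \<Rightarrow> nat set list \<Rightarrow> nat set" where
  "multicover_vertices m \<S> = (\<lambda>u. 4 * u + 2) ` {1..m} \<union> (\<lambda>u. 4 * u) ` {1..m} \<union>
     (\<lambda>i. 2 * i + 1) ` {..<length \<S>}"

text \<open>Truncated subtraction gives the right answer: if \<open>b\<close> exceeds the number of
  sets containing an element, its capacity is 0, so its pendant edge cannot be served, and indeed no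
  multicover exists.\<close>

definition multicover_cap :: "nat \<Rightarrow> nat set list \<Rightarrow> nat \<Rightarrow> nat \<Rightarrow> nat \<Rightarrow> nat" where
  "multicover_cap m \<S> b k v = (if odd v then k + m else if v mod 4 = 2 then 0
     else Suc (card {i. i < length \<S> \<and> v div 4 \<in> \<S> ! i}) - b)"

text \<open>Set vertices are odd, element vertices are 0 and pendant vertices 2 modulo 4. These
  rules let the simplifier keep the three kinds apart; the last two catch forms in which a
  \<open>Suc\<close> has been cancelled.\<close>

lemma double_neq [simp]: "Suc (2 * i) \<noteq> 4 * u" "4 * u \<noteq> Suc (2 * i)"
  "Suc (2 * i) \<noteq> Suc (Suc (4 * u))" "Suc (Suc (4 * u)) \<noteq> Suc (2 * i)"
  "Suc (Suc (4 * u)) \<noteq> 4 * v" "4 * v \<noteq> Suc (Suc (4 * u))" "Suc (4 * u) \<noteq> 2 * i" "2 * i \<noteq> Suc (4 * u)"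
  for i u v :: nat
  by presburger+

lemma multicover_cap_simps [simp]:
  "multicover_cap m \<S> b k (Suc (2 * i)) = k + m"
  "multicover_cap m \<S> b k (Suc (Suc (4 * u))) = 0"
  "multicover_cap m \<S> b k (4 * u) = Suc (card {i. i < length \<S> \<and> u \<in> \<S> ! i}) - b"
proof -
  have "Suc (Suc (4 * u)) mod 4 = 2" by presburger
  then show "multicover_cap m \<S> b k (Suc (Suc (4 * u))) = 0" by (simp add: multicover_cap_def)
qed (simp_all add: multicover_cap_def)

lemma multicover_edges_bounded:
  assumes "\<forall>A\<in>set \<S>. A \<subseteq> {1..m}"
  shows "multicover_edges m \<S> = (\<lambda>u. {4 * u + 2, 4 * u}) ` {1..m} \<union>
     {{2 * i + 1, 4 * u} | i u. i < length \<S> \<and> u \<in> \<S> ! i \<and> u \<in> {1..m}}"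
proof -
  have "u \<in> {1..m}" if "i < length \<S>" "u \<in> \<S> ! i" for i u
    using assms nth_mem[OF that(1)] that(2) by blast
  then show ?thesis
    unfolding multicover_edges_def by (intro arg_cong2[where f = "(\<union>)"] refl Collect_cong) blast
qed

lemma simple_graph_multicover:
  assumes "\<forall>A\<in>set \<S>. A \<subseteq> {1..m}"
  shows "simple_graph (multicover_vertices m \<S>) (multicover_edges m \<S>)"
  unfolding simple_graph_def multicover_edges_bounded[OF assms]
  by (auto simp: multicover_vertices_def)

lemma finite_multicover_edges:
  assumes "\<forall>A\<in>set \<S>. A \<subseteq> {1..m}"
  shows "finite (multicover_edges m \<S>)"
proof -
  have "multicover_edges m \<S> \<subseteq> Pow (multicover_vertices m \<S>)" "finite (multicover_vertices m \<S>)"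
    using simple_graph_multicover[OF assms] by (auto simp: simple_graph_def)
  then show ?thesis by (meson finite_Pow_iff finite_subset)
qed

lemma vertex_cover_number_multicover:
  assumes "\<forall>A\<in>set \<S>. A \<subseteq> {1..m}"
  shows "vertex_cover_number (multicover_vertices m \<S>) (multicover_edges m \<S>) \<le> m"
proof -
  let ?X = "(\<lambda>u. 4 * u) ` {1..m}"
  have fin: "finite (multicover_vertices m \<S>)" by (simp add: multicover_vertices_def)
  have "?X \<subseteq> multicover_vertices m \<S> \<and> (\<forall>e\<in>multicover_edges m \<S>. ?X \<inter> e \<noteq> {})"
    unfolding multicover_edges_bounded[OF assms] by (auto simp: multicover_vertices_def)
  then have "vertex_cover_number (multicover_vertices m \<S>) (multicover_edges m \<S>) \<le> card ?X"
    unfolding vertex_cover_number_def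
    using finite_subset[of "{X. X \<subseteq> multicover_vertices m \<S> \<and> (\<forall>e\<in>multicover_edges m \<S>. X \<inter> e \<noteq> {})}"
        "Pow (multicover_vertices m \<S>)"] fin
    by (intro Min_le finite_imageI imageI) blast+
  also have "\<dots> \<le> m" using card_image_le[of "{1..m}" "\<lambda>u. 4 * u"] by simp
  finally show ?thesis .
qed

text \<open>Translates, in both directions of the equivalence, between chosen sets containing an
  element and edges that the element vertex must serve itself.\<close>

lemma card_diff_chosen:
  fixes n :: nat
  assumes "I \<subseteq> {..<n}"
  shows "card {i. i < n \<and> P i \<and> i \<notin> I} + card {i \<in> I. P i} = card {i. i < n \<and> P i}"
proof -
  have "{i. i < n \<and> P i} = {i. i < n \<and> P i \<and> i \<notin> I} \<union> {i \<in> I. P i}" using assms by auto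
  moreover have "finite I" using assms by (rule finite_subset) simp
  ultimately show ?thesis
    using card_Un_disjoint[of "{i. i < n \<and> P i \<and> i \<notin> I}" "{i \<in> I. P i}"] by fastforce
qed

lemma set_multicover_imp_cover:
  assumes \<S>: "\<forall>A\<in>set \<S>. A \<subseteq> {1..m}" and "set_multicover m \<S> b k"
  shows "capacitated_vertex_cover (multicover_vertices m \<S>) (multicover_edges m \<S>)
    (multicover_cap m \<S> b k) (k + m)"
proof -
  obtain I where I: "I \<subseteq> {..<length \<S>}" "card I \<le> k"
    and b: "\<And>u. u \<in> {1..m} \<Longrightarrow> b \<le> card {i \<in> I. u \<in> \<S> ! i}"
    using assms(2) unfolding set_multicover_def by blast
  note E = multicover_edges_bounded[OF \<S>]
  define T where "T = (\<lambda>u. 4 * u) ` {1..m} \<union> (\<lambda>i. 2 * i + 1) ` I"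
  \<comment> \<open>An edge goes to its set vertex if that set is chosen, and otherwise to its
    element vertex, the only endpoint divisible by 4.\<close>
  define a :: "nat set \<Rightarrow> nat" where
    "a e = (if \<exists>i\<in>I. 2 * i + 1 \<in> e then THE v. v \<in> e \<and> odd v else THE v. v \<in> e \<and> 4 dvd v)" for e
  have not_dvd: "\<not> 4 dvd Suc (2 * i)" "\<not> 4 dvd Suc (Suc (4 * i))" for i :: nat by presburger+
  have a_leaf: "a {Suc (Suc (4 * u)), 4 * u} = 4 * u" for u
    unfolding a_def by (auto intro!: the_equality simp: not_dvd)
  have a_set: "a {Suc (2 * i), 4 * u} = (if i \<in> I then Suc (2 * i) else 4 * u)" for i u
    unfolding a_def by (auto intro!: the_equality simp: not_dvd)
  have "card T \<le> card ((\<lambda>u. 4 * u) ` {1..m}) + card ((\<lambda>i. 2 * i + 1) ` I)"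
    unfolding T_def by (rule card_Un_le)
  also have "\<dots> \<le> m + card I"
    using card_image_le[of "{1..m}" "\<lambda>u. 4 * u"] card_image_le[of I "\<lambda>i. 2 * i + 1"]
      finite_subset[OF I(1)] by (intro add_mono) auto
  finally have "card T \<le> k + m" using I(2) by simp
  moreover have "T \<subseteq> multicover_vertices m \<S>"
    using I(1) by (auto simp: T_def multicover_vertices_def)
  moreover have "a e \<in> e \<inter> T" if "e \<in> multicover_edges m \<S>" for e
    using that unfolding E by (auto simp: a_leaf a_set T_def)
  moreover have "card {e \<in> multicover_edges m \<S>. a e = v} \<le> multicover_cap m \<S> b k v" if "v \<in> T" for v
  proof -
    from that consider u where "u \<in> {1..m}" "v = 4 * u" | i where "i \<in> I" "v = Suc (2 * i)"
      by (auto simp: T_def)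
    then show ?thesis
    proof cases
      case (1 u)
      let ?J = "{i. i < length \<S> \<and> u \<in> \<S> ! i \<and> i \<notin> I}"
      \<comment> \<open>An element serves its pendant edge and the edges to unchosen sets. At least
        \<open>b\<close> sets containing it are chosen, which leaves exactly enough
        capacity.\<close>
      have "{e \<in> multicover_edges m \<S>. a e = v} \<subseteq>
          insert {Suc (Suc (4 * u)), 4 * u} ((\<lambda>i. {Suc (2 * i), 4 * u}) ` ?J)"
        unfolding E using 1 by (auto simp: a_leaf a_set split: if_splits)
      then have "card {e \<in> multicover_edges m \<S>. a e = v} \<le>
          card (insert {Suc (Suc (4 * u)), 4 * u} ((\<lambda>i. {Suc (2 * i), 4 * u}) ` ?J))"
        by (intro card_mono) auto
      also have "\<dots> \<le> Suc (card ?J)"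
        using card_image_le[of ?J "\<lambda>i. {Suc (2 * i), 4 * u}"]
        by (intro order_trans[OF card_insert_le_m1[of "Suc (card ?J)"]]) auto
      finally show ?thesis
        using card_diff_chosen[OF I(1), of "\<lambda>i. u \<in> \<S> ! i"] b[OF 1(1)] 1(2) by simp
    next
      case (2 i)
      have "{e \<in> multicover_edges m \<S>. a e = v} \<subseteq> (\<lambda>u. {Suc (2 * i), 4 * u}) ` {1..m}"
        unfolding E using 2 by (auto simp: a_leaf a_set split: if_splits)
      then have "card {e \<in> multicover_edges m \<S>. a e = v} \<le> m"
        using surj_card_le[of "{1..m}" "{e \<in> multicover_edges m \<S>. a e = v}"] by auto
      then show ?thesis using 2 by simp
    qed
  qed
  ultimately show ?thesis unfolding capacitated_vertex_cover_def by blast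
qed

lemma cover_imp_set_multicover:
  assumes \<S>: "\<forall>A\<in>set \<S>. A \<subseteq> {1..m}"
    and "capacitated_vertex_cover (multicover_vertices m \<S>) (multicover_edges m \<S>)
      (multicover_cap m \<S> b k) (k + m)"
  shows "set_multicover m \<S> b k"
proof -
  let ?E = "multicover_edges m \<S>"
  obtain T a where T: "T \<subseteq> multicover_vertices m \<S>" "card T \<le> k + m"
    and a: "\<And>e. e \<in> ?E \<Longrightarrow> a e \<in> e \<inter> T"
    and c: "\<And>v. v \<in> T \<Longrightarrow> card {e \<in> ?E. a e = v} \<le> multicover_cap m \<S> b k v"
    using assms(2) unfolding capacitated_vertex_cover_def by blast
  note finE = finite_multicover_edges[OF \<S>]
  define I where "I = {i. i < length \<S> \<and> Suc (2 * i) \<in> T}"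
  have I: "I \<subseteq> {..<length \<S>}" "finite I" by (auto simp: I_def)
  have a_leaf: "a {Suc (Suc (4 * u)), 4 * u} = 4 * u" if u: "u \<in> {1..m}" for u
  proof (rule ccontr)
    let ?e = "{Suc (Suc (4 * u)), 4 * u}"
    have e: "?e \<in> ?E" using u by (auto simp: multicover_edges_def)
    assume "a ?e \<noteq> 4 * u"
    then have *: "a ?e = Suc (Suc (4 * u))" "Suc (Suc (4 * u)) \<in> T" using a[OF e] by auto
    then have "{e \<in> ?E. a e = Suc (Suc (4 * u))} = {}"
      \<comment> \<open>Capacity 0 only yields cardinality 0; finiteness of the edge set turns this
        into emptiness.\<close>
      using c[OF *(2)] finE by simp
    then show False using * e by blast
  qed
  have elem: "4 * u \<in> T" if u: "u \<in> {1..m}" for u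
  proof -
    have "{Suc (Suc (4 * u)), 4 * u} \<in> ?E" using u by (auto simp: multicover_edges_def)
    from a[OF this] show ?thesis using a_leaf[OF u] by simp
  qed
  have "card I + m = card ((\<lambda>i. Suc (2 * i)) ` I) + card ((\<lambda>u. 4 * u) ` {1..m})"
    by (simp add: card_image inj_on_def)
  also have "\<dots> = card ((\<lambda>i. Suc (2 * i)) ` I \<union> (\<lambda>u. 4 * u) ` {1..m})"
    using I by (subst card_Un_disjoint) auto
  also have "\<dots> \<le> card T"
    using elem finite_subset[OF T(1)] by (intro card_mono) (auto simp: I_def multicover_vertices_def)
  finally have "card I \<le> k" using T(2) by simp
  moreover have "b \<le> card {i \<in> I. u \<in> \<S> ! i}" if u: "u \<in> {1..m}" for u
  proof -
    let ?J = "{i. i < length \<S> \<and> u \<in> \<S> ! i \<and> i \<notin> I}"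
    \<comment> \<open>The vertex of an unchosen set lies outside \<open>T\<close>, so such an edge
      has to be assigned to its element.\<close>
    have "a {Suc (2 * i), 4 * u} = 4 * u" "{Suc (2 * i), 4 * u} \<in> ?E" if "i \<in> ?J" for i
    proof -
      show e: "{Suc (2 * i), 4 * u} \<in> ?E" using that by (auto simp: multicover_edges_def)
      show "a {Suc (2 * i), 4 * u} = 4 * u" using a[OF e] that by (auto simp: I_def)
    qed
    moreover have "{Suc (Suc (4 * u)), 4 * u} \<in> ?E" using u by (auto simp: multicover_edges_def)
    ultimately have "insert {Suc (Suc (4 * u)), 4 * u} ((\<lambda>i. {Suc (2 * i), 4 * u}) ` ?J)
        \<subseteq> {e \<in> ?E. a e = 4 * u}"
      using a_leaf[OF u] by auto
    then have "card (insert {Suc (Suc (4 * u)), 4 * u} ((\<lambda>i. {Suc (2 * i), 4 * u}) ` ?J))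
        \<le> multicover_cap m \<S> b k (4 * u)"
      using finE by (intro order_trans[OF card_mono c[OF elem[OF u]]]) auto
    moreover have "inj_on (\<lambda>i. {Suc (2 * i), 4 * u}) ?J"
      by (auto simp: inj_on_def doubleton_eq_iff)
    \<comment> \<open>The left side is positive, so the subtraction is not truncated and
      \<open>card ?J + b\<close> is at most the number of sets containing \<open>u\<close>.\<close>
    ultimately have "Suc (card ?J) \<le> Suc (card {i. i < length \<S> \<and> u \<in> \<S> ! i}) - b"
      by (subst (asm) card_insert_disjoint) (auto simp: card_image doubleton_eq_iff)
    then show ?thesis using card_diff_chosen[OF I(1), of "\<lambda>i. u \<in> \<S> ! i"] by linarith
  qed
  ultimately show ?thesis unfolding set_multicover_def using I(1) by blast
qed


section \<open>Correctness of the reduction\<close>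

text \<open>A fold pushes its results to the front, so they appear in reverse order. Whole blocks
  \<open>f x\<close> are allowed because the edge loop adds all edges of a set in one round.\<close>

lemma fold_enc_list:
  assumes "\<And>x ys. x \<in> set xs \<Longrightarrow> F (j x) (enc_list h ys) = enc_list h (f x @ ys)"
  shows "fold F (map j xs) (enc_list h ys) = enc_list h (concat (rev (map f xs)) @ ys)"
  using assms by (induction xs arbitrary: ys) simp_all

lemma fold_Pair_enc_list:
  assumes "\<And>x. x \<in> set xs \<Longrightarrow> K (j x) = h (g x)"
  shows "fold (\<lambda>a. Pair (K a)) (map j xs) (enc_list h ys) = enc_list h (rev (map g xs) @ ys)"
  using assms by (induction xs arbitrary: ys) (simp_all flip: enc_list.simps(2))

lemma delem_enc_nat: "0 < u \<Longrightarrow> delem (enc_nat u) = enc_nat (4 * u)"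
  by (simp add: delem_def enc_nat.simps[of "4 * u"] enc_nat.simps[of "2 * u"])

lemma dleaf_enc_nat: "dleaf (enc_nat u) = enc_nat (4 * u + 2)"
proof -
  have "enc_nat (4 * u + 2) = Pair Atom (enc_nat (Suc (2 * u)))"
    by (subst enc_nat.simps) simp
  then show ?thesis by (simp add: dleaf_def enc_nat.simps[of "Suc (2 * u)"])
qed

lemma Pair_one_enc_nat: "Pair one (enc_nat i) = enc_nat (2 * i + 1)"
  by (simp add: enc_nat.simps[of "Suc (2 * i)"])

lemma fold_dinc: "fold (\<lambda>u. dinc) xs (enc_nat k) = enc_nat (k + length xs)"
  by (induction xs arbitrary: k) simp_all

lemma dlist_dindexed:
  "dlist (dindexed (enc_list h ls)) =
    map (\<lambda>i. Pair (enc_nat (2 * i + 1)) (h (ls ! i))) (rev [0..<length ls])"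
proof -
  define F where "F = (\<lambda>l acc. Pair (dinc (fst_data acc))
     (Pair (Pair (Pair one (fst_data acc)) l) (snd_data acc)))"
  have "\<exists>X. fold F (map h ls) (Pair Atom Atom) = Pair (enc_nat (length ls)) X \<and>
    dlist X = map (\<lambda>i. Pair (enc_nat (2 * i + 1)) (h (ls ! i))) (rev [0..<length ls])"
  proof (induction ls rule: rev_induct)
    case (snoc l ls)
    then obtain X where X: "fold F (map h ls) (Pair Atom Atom) = Pair (enc_nat (length ls)) X"
      "dlist X = map (\<lambda>i. Pair (enc_nat (2 * i + 1)) (h (ls ! i))) (rev [0..<length ls])" by blast
    have "fold F (map h (ls @ [l])) (Pair Atom Atom) = Pair (enc_nat (Suc (length ls)))
        (Pair (Pair (enc_nat (2 * length ls + 1)) (h l)) X)"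
      by (simp add: X(1)) (simp add: F_def Pair_one_enc_nat)
    moreover have "map (\<lambda>i. Pair (enc_nat (2 * i + 1)) (h ((ls @ [l]) ! i))) (rev [0..<length ls]) = dlist X"
      unfolding X(2) by (intro map_cong refl) (simp add: nth_append)
    ultimately show ?case by simp
  qed simp
  then show ?thesis unfolding dindexed_def F_def by auto
qed

section \<open>Output of the reduction on a fixed encoded instance\<close>

context
  fixes m b k :: nat and ls :: "nat list list" and \<S> :: "nat set list" and d :: data
  assumes \<S>: "\<S> = map set ls" "\<forall>A\<in>set \<S>. A \<subseteq> {1..m}" and ls: "\<forall>l\<in>set ls. distinct l"
    and d: "d = Pair (enc_list enc_nat [1..<Suc m])
             (Pair (enc_list (enc_list enc_nat) ls) (Pair (enc_nat b) (enc_nat k)))"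
begin

lemma dbudget_enc: "dbudget d = enc_nat (k + m)"
  by (simp add: dbudget_def d fold_dinc del: upt_Suc)

text \<open>The order is that in which the folds push the vertices. Set vertices appear in
  increasing order because the reversal by the fold undoes the one in
  \<open>dindexed\<close>.\<close>

definition vertex_list :: "nat list" where
  "vertex_list = rev (map (\<lambda>u. 4 * u + 2) [1..<Suc m]) @ rev (map (\<lambda>u. 4 * u) [1..<Suc m]) @
     map (\<lambda>i. 2 * i + 1) [0..<length ls]"

definition edge_list :: "(nat \<times> nat) list" where
  "edge_list = rev (map (\<lambda>u. (4 * u + 2, 4 * u)) [1..<Suc m]) @
     concat (map (\<lambda>i. rev (map (\<lambda>u. (2 * i + 1, 4 * u)) (ls ! i))) [0..<length ls])"

lemma pos_elem: "i < length ls \<Longrightarrow> u \<in> set (ls ! i) \<Longrightarrow> 0 < u"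
  using \<S> nth_mem[of i ls] by (force simp: subset_iff)

lemma dvertices_enc:
  "dvertices d = enc_list (enc_prod enc_nat enc_nat) (map (\<lambda>v. (v, multicover_cap m \<S> b k v)) vertex_list)"
proof -
  let ?h = "enc_prod enc_nat enc_nat"
  let ?c = "multicover_cap m \<S> b k"
  let ?us = "[1..<Suc m]"
  have 1: "fold (\<lambda>p. Pair (Pair (fst_data p) (enc_nat (k + m)))) (dlist (dindexed (enc_list (enc_list enc_nat) ls))) Atom
    = enc_list ?h (map (\<lambda>i. (2 * i + 1, ?c (2 * i + 1))) [0..<length ls])"
    unfolding dlist_dindexed
    by (subst fold_Pair_enc_list[where ys = "[]" and h = ?h and g = "\<lambda>i. (2 * i + 1, ?c (2 * i + 1))", simplified enc_list.simps])
       (simp_all add: rev_map)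
  have cap: "dcap (enc_nat u) (enc_list (enc_list enc_nat) ls) (enc_nat b) = enc_nat (?c (4 * u))" for u
    by (simp add: dcap_enc length_filter_conv_card \<S>(1) cong: conj_cong)
  have 2: "fold (\<lambda>u. Pair (Pair (delem u) (dcap u (enc_list (enc_list enc_nat) ls) (enc_nat b))))
     (map enc_nat ?us) (enc_list ?h ys) = enc_list ?h (rev (map (\<lambda>u. (4 * u, ?c (4 * u))) ?us) @ ys)" for ys
    by (intro fold_Pair_enc_list) (auto simp: cap delem_enc_nat)
  have 3: "fold (\<lambda>u. Pair (Pair (dleaf u) Atom)) (map enc_nat ?us) (enc_list ?h ys)
     = enc_list ?h (rev (map (\<lambda>u. (4 * u + 2, ?c (4 * u + 2))) ?us) @ ys)" for ys
    by (intro fold_Pair_enc_list) (auto simp: dleaf_enc_nat)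
  show ?thesis
    unfolding dvertices_def dbudget_enc unfolding d fst_data.simps snd_data.simps dlist_enc_list 1 2 3
    by (simp add: vertex_list_def rev_map comp_def del: upt_Suc)
qed

lemma dedges_enc: "dedges d = enc_list (enc_prod enc_nat enc_nat) edge_list"
proof -
  let ?h = "enc_prod enc_nat enc_nat"
  let ?F = "\<lambda>p acc. fold (\<lambda>u. Pair (Pair (fst_data p) (delem u))) (dlist (snd_data p)) acc"
  let ?j = "\<lambda>i. Pair (enc_nat (2 * i + 1)) (enc_list enc_nat (ls ! i))"
  let ?f = "\<lambda>i. rev (map (\<lambda>u. (2 * i + 1, 4 * u)) (ls ! i))"
  have step: "?F (?j i) (enc_list ?h ys) = enc_list ?h (?f i @ ys)" if "i \<in> set (rev [0..<length ls])" for i ys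
    using that pos_elem[of i] unfolding snd_data.simps dlist_enc_list
    by (intro fold_Pair_enc_list) (auto simp: delem_enc_nat)
  have "fold ?F (map ?j (rev [0..<length ls])) (enc_list ?h [])
    = enc_list ?h (concat (rev (map ?f (rev [0..<length ls]))) @ [])"
    by (rule fold_enc_list) (rule step)
  then have 1: "fold ?F (dlist (dindexed (enc_list (enc_list enc_nat) ls))) Atom
    = enc_list ?h (concat (map ?f [0..<length ls]))"
    by (simp only: dlist_dindexed rev_map rev_rev_ident enc_list.simps append_Nil2)
  have 2: "fold (\<lambda>u. Pair (Pair (dleaf u) (delem u))) (map enc_nat [1..<Suc m]) (enc_list ?h ys)
     = enc_list ?h (rev (map (\<lambda>u. (4 * u + 2, 4 * u)) [1..<Suc m]) @ ys)" for ys
    by (intro fold_Pair_enc_list) (auto simp: dleaf_enc_nat delem_enc_nat)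
  show ?thesis
    unfolding dedges_def d fst_data.simps snd_data.simps dlist_enc_list 1 2 edge_list_def ..
qed

lemma set_vertex_list: "set vertex_list = multicover_vertices m \<S>"
  unfolding vertex_list_def multicover_vertices_def \<S>(1)
  by (simp add: atLeastLessThanSuc_atLeastAtMost lessThan_atLeast0 Un_assoc del: upt_Suc)

lemma distinct_vertex_list: "distinct vertex_list"
  unfolding vertex_list_def by (auto simp: distinct_map inj_on_def simp del: upt_Suc)

lemma set_edge_list: "set (map (\<lambda>(u, v). {u, v}) edge_list) = multicover_edges m \<S>"
proof -
  have "set (map (\<lambda>(u, v). {u, v}) edge_list) = (\<lambda>u. {4 * u + 2, 4 * u}) ` {1..m} \<union>
      (\<Union>i\<in>{0..<length ls}. (\<lambda>u. {2 * i + 1, 4 * u}) ` set (ls ! i))"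
    unfolding edge_list_def
    by (simp add: atLeastLessThanSuc_atLeastAtMost image_Un image_image image_UN del: upt_Suc)
  also have "\<dots> = multicover_edges m \<S>"
  proof -
    have "{h i u | i u. i < n \<and> u \<in> B i} = (\<Union>i\<in>{0..<n}. h i ` B i)"
      for h :: "nat \<Rightarrow> nat \<Rightarrow> nat set" and n B by (auto, blast)
    from this[of "\<lambda>i u. {2 * i + 1, 4 * u}" "length ls" "\<lambda>i. map set ls ! i"]
    show ?thesis unfolding multicover_edges_def \<S>(1) by simp
  qed
  finally show ?thesis .
qed

lemma distinct_edge_list: "distinct (map (\<lambda>(u, v). {u, v}) edge_list)"
proof -
  have sets: "distinct (concat (map (\<lambda>i. rev (map (\<lambda>u. (2 * i + 1, 4 * u)) (ls ! i))) [0..<n]))"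
    if "n \<le> length ls" for n
    using that
  proof (induction n)
    case (Suc n)
    then have "distinct (ls ! n)" using ls by simp
    then show ?case using Suc by (auto simp: distinct_map inj_on_def)
  qed simp
  have "distinct edge_list"
    using sets[of "length ls"] unfolding edge_list_def
    by (auto simp: distinct_map inj_on_def simp del: upt_Suc)
  \<comment> \<open>Forgetting the order of endpoints loses nothing: in every pair the second
    component is a multiple of 4 and the first is not.\<close>
  moreover have "inj_on (\<lambda>(u, v). {u, v}) (set edge_list)"
    unfolding edge_list_def by (auto simp: inj_on_def doubleton_eq_iff simp del: upt_Suc)
  ultimately show ?thesis by (simp add: distinct_map)
qed

lemma cvc_codes_reduction:
  "cvc_codes (multicover_vertices m \<S>, multicover_edges m \<S>, multicover_cap m \<S> b k, k + m) (reduction d)"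
  using distinct_vertex_list set_vertex_list distinct_edge_list set_edge_list
  by (auto simp: reduction_def dvertices_enc dedges_enc dbudget_enc)

end

section \<open>Transfer of the running time\<close>

text \<open>The assumed algorithm is only known to work from \<open>input_store\<close>, while the
  reduction leaves intermediate values in its variables.\<close>

primrec clear_vars :: "nat \<Rightarrow> prog" where
  "clear_vars 0 = Skip"
| "clear_vars (Suc n) = Seq (clear_vars n) (Assign (Suc n) ENil)"

lemma exec_clear_vars:
  "exec (clear_vars n) s (1 + 2 * n) (\<lambda>x. if 0 < x \<and> x \<le> n then Atom else s x)"
proof (induction n)
  case (Suc n)
  have "exec (clear_vars (Suc n)) s (1 + 2 * n + 2)
     ((\<lambda>x. if 0 < x \<and> x \<le> n then Atom else s x)(Suc n := Atom))"
    unfolding clear_vars.simps by (rule exec_Seq[OF Suc]) (rule exec_AssignI; simp)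
  moreover have "(\<lambda>x. if 0 < x \<and> x \<le> n then Atom else s x)(Suc n := Atom)
     = (\<lambda>x. if 0 < x \<and> x \<le> Suc n then Atom else s x)" by auto
  ultimately show ?case by (simp add: add.commute)
next
  case 0
  have "(\<lambda>x. if 0 < x \<and> x \<le> 0 then Atom else s x) = s" by auto
  then show ?case using exec_Skip by simp
qed

text \<open>The finitely many arguments below the threshold of the asymptotic bound are absorbed by
  the constant \<open>D\<close>, which makes the estimate valid everywhere.\<close>

lemma bigo_nat_le:
  fixes g f :: "nat \<Rightarrow> real"
  assumes "g \<in> O(f)"
  obtains C D where "0 \<le> C" "0 \<le> D" "\<And>n. g n \<le> C * \<bar>f n\<bar> + D"
proof -
  obtain C where C: "C > 0" "\<forall>\<^sub>F n in sequentially. norm (g n) \<le> C * norm (f n)"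
    using assms by (rule landau_o.bigE)
  obtain N where N: "\<And>n. n \<ge> N \<Longrightarrow> \<bar>g n\<bar> \<le> C * \<bar>f n\<bar>"
    using C(2) by (auto simp: eventually_sequentially)
  show thesis
  proof (rule that[of C "\<Sum>i<N. \<bar>g i\<bar>"])
    show "g n \<le> C * \<bar>f n\<bar> + (\<Sum>i<N. \<bar>g i\<bar>)" for n
    proof (cases "n < N")
      case True
      then have "\<bar>g n\<bar> \<le> (\<Sum>i<N. \<bar>g i\<bar>)" by (intro member_le_sum) auto
      moreover have "0 \<le> C * \<bar>f n\<bar>" using C by simp
      ultimately show ?thesis by linarith
    next
      case False
      moreover have "0 \<le> (\<Sum>i<N. \<bar>g i\<bar>)" by (rule sum_nonneg) simp
      ultimately show ?thesis using N[of n] by linarith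
    qed
  qed (use C in \<open>auto intro: sum_nonneg\<close>)
qed

text \<open>For a negative exponent the function decreases, which the summand 1 makes up for.\<close>

lemma nat_powr_le:
  assumes "v \<le> m"
  shows "real v powr a \<le> real m powr a + 1"
proof (cases "0 \<le> a")
  case True
  then have "real v powr a \<le> real m powr a" using assms by (intro powr_mono2) auto
  then show ?thesis by simp
next
  case False
  have "real v powr a \<le> 1"
  proof (cases "v = 0")
    case v: False
    then have "real v powr a \<le> real v powr 0" using False by (intro powr_mono) auto
    then show ?thesis using v by simp
  qed simp
  then show ?thesis by (simp add: add.commute add_increasing2)
qed

theorem theorem4p1:
  fixes \<epsilon> :: real
  assumes "\<epsilon> > 0"
    and "solvable_in_2_to_O_poly cvc_instances cvc_codes cvc_yes cvc_param
           (\<lambda>vc. real vc powr (2 - \<epsilon>))"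
  shows "solvable_in_2_to_O_poly smc_instances smc_codes smc_yes smc_param
           (\<lambda>m. real m powr (2 - \<epsilon>))"
proof -
  obtain p g q e where g: "g \<in> O(\<lambda>vc. real vc powr (2 - \<epsilon>))" and q: "q \<in> O(\<lambda>n. real n ^ e)"
    and p: "\<And>x d. x \<in> cvc_instances \<Longrightarrow> cvc_codes x d \<Longrightarrow>
        \<exists>t s. exec p (input_store d) t s \<and> real t \<le> 2 powr g (cvc_param x) * q (data_size d) \<and>
               (s 0 \<noteq> Atom \<longleftrightarrow> cvc_yes x)"
    using assms(2) unfolding solvable_in_2_to_O_poly_def by metis
  obtain C D where C: "0 \<le> C" "0 \<le> D" "\<And>v. g v \<le> C * real v powr (2 - \<epsilon>) + D"
    using bigo_nat_le[OF g] by auto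
  obtain A B where A: "0 \<le> A" "0 \<le> B" "\<And>n. q n \<le> A * real n ^ e + B"
    using bigo_nat_le[OF q] by auto
  obtain r T where T: "poly_bounded T" and
    r: "\<And>s. \<exists>t s'. exec r s t s' \<and> s' 0 = reduction (s 0) \<and> t \<le> T (s 0) \<and> (\<forall>x\<ge>var_bound r. s' x = s x)"
    by (rule poly_timeE[OF poly_time_reduction], rule that)
  define N where "N = var_bound r"
  define g' where "g' m = C * real m powr (2 - \<epsilon>)" for m :: nat
  \<comment> \<open>The exponent exceeds \<open>g' m\<close> by at most \<open>D\<close> from the
    asymptotic bound plus \<open>C\<close> from the summand 1 in \<open>nat_powr_le\<close>. The
    resulting factor \<open>K\<close> joins the polynomial.\<close>
  define K where "K = 2 powr (C + D)"
  \<comment> \<open>\<open>poly_bounded\<close> concerns natural numbers, so the real coefficients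
    are rounded up.\<close>
  obtain A' B' :: nat where A': "K * A \<le> real A'" "K * B \<le> real B'"
    using real_arch_simple by meson
  define h where "h d = T d + (1 + 2 * N) + (A' * data_size (reduction d) ^ e + B')" for d
  have "poly_bounded h"
    unfolding h_def by (intro poly_bounded_intros T poly_time_size[OF poly_time_reduction])
  then obtain c e' where h: "\<And>d. h d \<le> c * data_size d ^ e'"
    unfolding poly_bounded_def by blast
  have "\<exists>t s. exec (Seq r (Seq (clear_vars N) p)) (input_store d) t s \<and>
         real t \<le> 2 powr g' (smc_param x) * (real c * real (data_size d) ^ e') \<and>
         (s 0 \<noteq> Atom \<longleftrightarrow> smc_yes x)"
    if "x \<in> smc_instances" "smc_codes x d" for x d
  proof -
    obtain m \<S> b k where x: "x = (m, \<S>, b, k)" by (metis prod_cases4)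
    have \<S>: "\<forall>A\<in>set \<S>. A \<subseteq> {1..m}" using that(1) by (auto simp: x smc_instances_def)
    define y where "y = (multicover_vertices m \<S>, multicover_edges m \<S>, multicover_cap m \<S> b k, k + m)"
    have y: "y \<in> cvc_instances"
      using simple_graph_multicover[OF \<S>] by (simp add: y_def cvc_instances_def)
    have codes: "cvc_codes y (reduction d)"
      using that(2) cvc_codes_reduction[OF _ \<S>] unfolding x y_def smc_codes.simps by blast
    have yes: "cvc_yes y \<longleftrightarrow> smc_yes x"
      using set_multicover_imp_cover[OF \<S>] cover_imp_set_multicover[OF \<S>] by (auto simp: x y_def)
    have vc: "cvc_param y \<le> m" using vertex_cover_number_multicover[OF \<S>] by (simp add: y_def)
    obtain t1 s1 where 1: "exec r (input_store d) t1 s1" "s1 0 = reduction d" "t1 \<le> T d"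
      "\<forall>x\<ge>N. s1 x = input_store d x"
      using r[of "input_store d"] by (auto simp: input_store_def N_def)
    \<comment> \<open>Variables above \<open>N\<close> were never touched by \<open>r\<close> and
      still hold \<open>Atom\<close>; hence clearing \<open>1\<close> to \<open>N\<close> gives
      precisely a fresh input store.\<close>
    have "(\<lambda>x. if 0 < x \<and> x \<le> N then Atom else s1 x) = input_store (reduction d)"
      using 1 by (auto simp: input_store_def fun_eq_iff)
    then have 2: "exec (clear_vars N) s1 (1 + 2 * N) (input_store (reduction d))"
      using exec_clear_vars[of N s1] by simp
    obtain t s where 3: "exec p (input_store (reduction d)) t s"
       "real t \<le> 2 powr g (cvc_param y) * q (data_size (reduction d))" "s 0 \<noteq> Atom \<longleftrightarrow> cvc_yes y"
      using p[OF y codes] by blast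
    have "g (cvc_param y) \<le> C * (real m powr (2 - \<epsilon>) + 1) + D"
      using C(3)[of "cvc_param y"] mult_left_mono[OF nat_powr_le[OF vc] C(1)] by (meson add_mono order_refl order_trans)
    then have "2 powr g (cvc_param y) \<le> 2 powr (g' m + (C + D))"
      by (intro powr_mono) (auto simp: g'_def algebra_simps)
    then have gm: "2 powr g (cvc_param y) \<le> 2 powr g' m * K" by (simp add: K_def powr_add)
    let ?n = "data_size (reduction d)"
    have "real t \<le> 2 powr g (cvc_param y) * (A * real ?n ^ e + B)"
      using 3(2) A(3)[of ?n] by (meson mult_left_mono order_trans powr_ge_zero)
    also have "\<dots> \<le> 2 powr g' m * K * (A * real ?n ^ e + B)"
      using gm A by (intro mult_right_mono) auto
    also have "\<dots> = 2 powr g' m * (K * A * real ?n ^ e + K * B)" by (simp add: algebra_simps)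
    also have "\<dots> \<le> 2 powr g' m * (real A' * real ?n ^ e + real B')"
      using A' by (intro mult_left_mono add_mono mult_right_mono) auto
    finally have t: "real t \<le> 2 powr g' m * (real A' * real ?n ^ e + real B')" .
    \<comment> \<open>The exponent is nonnegative, so the time for the reduction and the clearing,
      which is only added, can be put under the exponential factor too.\<close>
    have "1 \<le> 2 powr g' m" using C(1) by (auto simp: g'_def intro: ge_one_powr_ge_zero)
    then have "real (t1 + (1 + 2 * N)) \<le> 2 powr g' m * real (T d + (1 + 2 * N))"
      using 1(3) mult_mono[of 1 "2 powr g' m" "real (t1 + (1 + 2 * N))" "real (T d + (1 + 2 * N))"] by simp
    with t have "real (t1 + (1 + 2 * N + t)) \<le> 2 powr g' m * real (h d)"
      by (simp add: h_def algebra_simps)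
    also have "\<dots> \<le> 2 powr g' m * (real c * real (data_size d) ^ e')"
      using h[of d] by (intro mult_left_mono) (simp_all flip: of_nat_power of_nat_mult)
    finally show ?thesis
      using exec_Seq[OF 1(1) exec_Seq[OF 2 3(1)]] 3(3) yes x by (intro exI conjI) auto
  qed
  moreover have "g' \<in> O(\<lambda>m. real m powr (2 - \<epsilon>))"
    unfolding g'_def by simp
  moreover have "(\<lambda>n. real c * real n ^ e') \<in> O(\<lambda>n. real n ^ e')" by simp
  ultimately show ?thesis unfolding solvable_in_2_to_O_poly_def by blast
qed

end
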